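(* Let $K$ be a field and let $\mathcal{P}$ be a thin collection of cells such that: (1) there is no $(i,j)$ such that the three cells with upper-left vertices $(i,j)$, $(i+1,j-1)$ and $(i+2,j-2)$ all belong to $\mathcal{P}$; (2) if $I$ is a maximal inner interval of $\mathcal{P}$ with vertices $(i_1,j_1)$, $(i_1+1,j_1)$, $(i_1,j_2)$ and $(i_1+1,j_2)$, where $j_1<j_2$, then neither the cell with lower-right vertex $(i_1,j_2)$ nor the cell with upper-left vertex $(i_1+1,j_1)$ is contained in $\mathcal{P}$; (3) if $I$ is a maximal inner interval of $\mathcal{P}$ with vertices $(i_1,j_1)$, $(i_1,j_1+1)$, $(i_2,j_1)$ and $(i_2,j_1+1)$, where $i_1<i_2$, then neither the cell with lower-right vertex $(i_1,j_1+1)$ nor the cell with upper-left vertex $(i_2,j_1)$ is contained in $\mathcal{P}$. Then the set of all binomials corresponding to inner intervals of $\mathcal{P}$ forms a Gröbner basis of $I_{\mathcal{P}}\subset S=K[x_a\mid a\in V(\mathcal{P})]$ with respect to the graded reverse lexicographic order $<$ on $S$ induced by: $x_{i,j}<x_{k,l}$ if $i<k$, or $i=k$ and $j<l$. Moreover, when $\mathcal{P}$ is a polyomino, $I_{\mathcal{P}}$ is a prime ideal.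
   Context: $\mathbb{N}$ is the set of nonnegative integers, and $(i,j)\le (k,l)$ in $\mathbb{N}^2$ means $i\le k$ and $j\le l$. For $a=(i,j)\le b=(k,l)$ put $[a,b]=\{m\in\mathbb{N}^2: a\le m\le b\}$; it is a proper interval if $i<k$ and $j<l$. The vertices of a proper interval are $a$ (lower-left), $b$ (upper-right), $(i,l)$ (upper-left) and $(k,j)$ (lower-right); the last two are its anti-diagonal vertices. A cell is $C=[a,a+(1,1)]$; $V(C)$ is the set of its four vertices and its edges are the four pairs of adjacent vertices. For a finite collection of cells $\mathcal{P}$, $V(\mathcal{P})=\bigcup_{C\in\mathcal{P}}V(C)$. $\mathcal{P}$ is thin if it does not contain four cells forming a $2\times 2$ square. A polyomino is a non-empty finite collection of cells in $(\mathbb{N}\setminus\{0\})^2$ such that any two of its cells $C,D$ are joined by a sequence of cells $C=C_1,\dots,C_m=D$ of the collection with $C_i\cap C_{i+1}$ an edge of both for all $i$. An inner interval of $\mathcal{P}$ is a proper interval $[a,b]$ with $a,b\in V(\mathcal{P})$ all of whose cells belong to $\mathcal{P}$; it is maximal if it is maximal under inclusion. The binomial corresponding to $[a,b]$ is $x_ax_b-x_cx_d$, where $c,d$ are the anti-diagonal vertices of $[a,b]$. $I_{\mathcal{P}}\subset S$ is the ideal generated by these binomials for all inner intervals of $\mathcal{P}$. *)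

theory Defs
  imports
    "HOL-Library.Poly_Mapping"
    "HOL-Library.Product_Order"
    "HOL-Library.Product_Plus"
    "HOL-Algebra.Ideal"
begin

section \<open>Polynomial rings, initial monomials and Groebner bases\<close>

text \<open>A monomial is a finitely supported exponent vector, and a polynomial is a finitely
  supported map from monomials to coefficients, with the convolution product of
  \<^theory>\<open>HOL-Library.Poly_Mapping\<close>.\<close>

type_synonym 'v monomial = "'v \<Rightarrow>\<^sub>0 nat"
type_synonym ('v, 'k) mpoly = "'v monomial \<Rightarrow>\<^sub>0 'k"

definition mpoly_ring :: "'v set \<Rightarrow> ('v, 'k::field) mpoly ring"
  where "mpoly_ring V =
    \<lparr>carrier = {f. \<forall>m\<in>Poly_Mapping.keys f. Poly_Mapping.keys m \<subseteq> V},
     mult = (*), one = 1, zero = 0, add = (+)\<rparr>"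

definition var :: "'v \<Rightarrow> ('v, 'k::field) mpoly"
  where "var a = Poly_Mapping.single (Poly_Mapping.single a 1) 1"

definition monom :: "'v monomial \<Rightarrow> ('v, 'k::field) mpoly"
  where "monom m = Poly_Mapping.single m 1"

definition mdegree :: "'v monomial \<Rightarrow> nat"
  where "mdegree m = (\<Sum>a\<in>Poly_Mapping.keys m. Poly_Mapping.lookup m a)"

text \<open>Graded reverse lexicographic order induced by the strict total order \<open>lt\<close> on the variables:
  in equal degree, the monomial with the larger exponent at the smallest variable where
  the exponents differ is the smaller one.\<close>

definition grevlex :: "('v \<Rightarrow> 'v \<Rightarrow> bool) \<Rightarrow> 'v monomial \<Rightarrow> 'v monomial \<Rightarrow> bool"
  where "grevlex lt m n \<longleftrightarrow>
    mdegree m < mdegree n \<or>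
    (mdegree m = mdegree n \<and>
      (\<exists>a. Poly_Mapping.lookup m a > Poly_Mapping.lookup n a \<and>
        (\<forall>b. lt b a \<longrightarrow> Poly_Mapping.lookup m b = Poly_Mapping.lookup n b)))"

text \<open>Meaningful for \<open>f \<noteq> 0\<close> and a strict total order \<open>prec\<close> on monomials.\<close>

definition initial_monomial ::
    "('v monomial \<Rightarrow> 'v monomial \<Rightarrow> bool) \<Rightarrow> ('v, 'k::field) mpoly \<Rightarrow> 'v monomial"
  where "initial_monomial prec f =
    (THE m. m \<in> Poly_Mapping.keys f \<and> (\<forall>n\<in>Poly_Mapping.keys f. n \<noteq> m \<longrightarrow> prec n m))"

definition initial_ideal ::
    "('v monomial \<Rightarrow> 'v monomial \<Rightarrow> bool) \<Rightarrow> 'v set \<Rightarrow> ('v, 'k::field) mpoly set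
      \<Rightarrow> ('v, 'k) mpoly set"
  where "initial_ideal prec V F =
    genideal (mpoly_ring V) {monom (initial_monomial prec f) | f. f \<in> F \<and> f \<noteq> 0}"

definition groebner_basis ::
    "('v monomial \<Rightarrow> 'v monomial \<Rightarrow> bool) \<Rightarrow> 'v set \<Rightarrow> ('v, 'k::field) mpoly set
      \<Rightarrow> ('v, 'k) mpoly set \<Rightarrow> bool"
  where "groebner_basis prec V G I \<longleftrightarrow>
    finite G \<and> 0 \<notin> G \<and> G \<subseteq> I \<and> initial_ideal prec V G = initial_ideal prec V I"


section \<open>Collections of cells\<close>

text \<open>Points are pairs of naturals with the componentwise order of
  \<^theory>\<open>HOL-Library.Product_Order\<close>, so the interval \<open>[a,b]\<close> is \<open>{a..b}\<close>.
  A cell is such a set of points, hence the intersection of two cells is the set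
  of their common vertices.\<close>

type_synonym point = "nat \<times> nat"

definition proper :: "point \<Rightarrow> point \<Rightarrow> bool"
  where "proper a b \<longleftrightarrow> fst a < fst b \<and> snd a < snd b"

definition upper_left :: "point \<Rightarrow> point \<Rightarrow> point"
  where "upper_left a b = (fst a, snd b)"

definition lower_right :: "point \<Rightarrow> point \<Rightarrow> point"
  where "lower_right a b = (fst b, snd a)"

definition cell :: "point \<Rightarrow> point set"
  where "cell a = {a..a + (1, 1)}"

definition collection_of_cells :: "point set set \<Rightarrow> bool"
  where "collection_of_cells P \<longleftrightarrow> finite P \<and> P \<subseteq> range cell"

definition cell_vertices :: "point \<Rightarrow> point set"
  where "cell_vertices a =
    {a, a + (1, 1), upper_left a (a + (1, 1)), lower_right a (a + (1, 1))}"

definition vertices :: "point set set \<Rightarrow> point set"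
  where "vertices P = (\<Union>a\<in>{a. cell a \<in> P}. cell_vertices a)"

definition is_edge :: "point set \<Rightarrow> point set \<Rightarrow> bool"
  where "is_edge e C \<longleftrightarrow> (\<exists>a. C = cell a \<and>
    e \<in> {{a, a + (1, 0)}, {a, a + (0, 1)},
         {a + (1, 0), a + (1, 1)}, {a + (0, 1), a + (1, 1)}})"

definition thin :: "point set set \<Rightarrow> bool"
  where "thin P \<longleftrightarrow>
    \<not> (\<exists>a. {cell a, cell (a + (1, 0)), cell (a + (0, 1)), cell (a + (1, 1))} \<subseteq> P)"

definition polyomino :: "point set set \<Rightarrow> bool"
  where "polyomino P \<longleftrightarrow>
    P \<noteq> {} \<and> collection_of_cells P \<and> (\<forall>C\<in>P. \<forall>v\<in>C. fst v \<noteq> 0 \<and> snd v \<noteq> 0) \<and>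
    (\<forall>C\<in>P. \<forall>D\<in>P. \<exists>Cs. Cs \<noteq> [] \<and> hd Cs = C \<and> last Cs = D \<and> set Cs \<subseteq> P \<and>
      (\<forall>i. Suc i < length Cs \<longrightarrow>
        is_edge (Cs ! i \<inter> Cs ! Suc i) (Cs ! i) \<and>
        is_edge (Cs ! i \<inter> Cs ! Suc i) (Cs ! Suc i)))"

definition has_cell_with_upper_left :: "point set set \<Rightarrow> point \<Rightarrow> bool"
  where "has_cell_with_upper_left P v \<longleftrightarrow> (\<exists>a. cell a \<in> P \<and> upper_left a (a + (1, 1)) = v)"

definition has_cell_with_lower_right :: "point set set \<Rightarrow> point \<Rightarrow> bool"
  where "has_cell_with_lower_right P v \<longleftrightarrow> (\<exists>a. cell a \<in> P \<and> lower_right a (a + (1, 1)) = v)"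

definition inner_interval :: "point set set \<Rightarrow> point \<Rightarrow> point \<Rightarrow> bool"
  where "inner_interval P a b \<longleftrightarrow>
    proper a b \<and> a \<in> vertices P \<and> b \<in> vertices P \<and> (\<forall>c. cell c \<subseteq> {a..b} \<longrightarrow> cell c \<in> P)"

definition maximal_inner_interval :: "point set set \<Rightarrow> point \<Rightarrow> point \<Rightarrow> bool"
  where "maximal_inner_interval P a b \<longleftrightarrow>
    inner_interval P a b \<and> (\<forall>c d. inner_interval P c d \<longrightarrow> \<not> {a..b} \<subset> {c..d})"


section \<open>The ideal of a collection of cells\<close>

definition interval_binomial :: "point \<Rightarrow> point \<Rightarrow> (point, 'k::field) mpoly"
  where "interval_binomial a b = var a * var b - var (upper_left a b) * var (lower_right a b)"

definition inner_binomials :: "point set set \<Rightarrow> (point, 'k::field) mpoly set"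
  where "inner_binomials P = {interval_binomial a b | a b. inner_interval P a b}"

definition polyomino_ideal :: "point set set \<Rightarrow> (point, 'k::field) mpoly set"
  where "polyomino_ideal P = genideal (mpoly_ring (vertices P)) (inner_binomials P)"

definition var_less :: "point \<Rightarrow> point \<Rightarrow> bool"
  where "var_less a b \<longleftrightarrow> fst a < fst b \<or> (fst a = fst b \<and> snd a < snd b)"

end

theory Submission
  imports Defs "HOL-Library.Nat_Bijection"
begin

text \<open>Replacing the antidiagonal vertices of an inner interval by the diagonal ones rewrites a
  monomial into a smaller one, modulo the ideal. Everything rests on one fact: two irreducible
  monomials whose exponent vectors differ by an integer combination of the cell binomials, with
  coefficient \<open>w C\<close> at the cell \<open>C\<close>, are equal. On a maximal inner interval of width one the
  partial sums of the difference of the exponents along the two long sides are differences of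
  weights of neighbouring cells, the conditions on the corners of maximal intervals making the
  boundary terms vanish; irreducibility then forces \<open>w C\<close> to lie between the
  weights of the two cells that adjoin \<open>C\<close> across the interval (\<open>0\<close>
  for a missing cell). So a cell of maximal positive weight has a vertical and a horizontal
  neighbour of the same weight, and the lowest leftmost of these cells begins a \<open>2
  \<times> 2\<close> square, which thinness excludes.

  Sending a monomial to its class modulo the lattice of the cell binomials yields a toric map into
  an integral domain whose kernel contains the ideal. Since each class contains at most one
  irreducible monomial, initial monomials of elements of the kernel are reducible. Hence the
  binomials form a Groebner basis of the kernel, and the kernel is the ideal, which is prime.\<close>

section \<open>Cells and inner intervals\<close>

lemma cell_subset_iff: "cell a \<subseteq> {x..y} \<longleftrightarrow> x \<le> a \<and> a + (1, 1) \<le> y"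
proof -
  have "a \<le> a + (1, 1)"
    by (simp add: less_eq_prod_def)
  then show ?thesis
    unfolding cell_def by (auto simp: atLeastatMost_subset_iff)
qed

lemma inj_cell: "inj cell"
proof (rule injI)
  fix a b :: point
  assume "cell a = cell b"
  moreover have "a \<le> a + (1, 1)" "b \<le> b + (1, 1)"
    by (simp_all add: less_eq_prod_def)
  ultimately show "a = b"
    unfolding cell_def by (simp add: Icc_eq_Icc)
qed

lemma finite_vertices: "finite P \<Longrightarrow> finite (vertices P)"
  unfolding vertices_def cell_vertices_def
  using finite_vimageI[OF _ inj_cell, of P] by (auto simp: vimage_def)

lemma vertices_cellI:
  assumes "cell (i, j) \<in> P"
  shows "(i, j) \<in> vertices P" "(Suc i, Suc j) \<in> vertices P"
    "(i, Suc j) \<in> vertices P" "(Suc i, j) \<in> vertices P"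
proof -
  have "cell_vertices (i, j) \<subseteq> vertices P"
    using assms unfolding vertices_def by blast
  then show "(i, j) \<in> vertices P" "(Suc i, Suc j) \<in> vertices P"
    "(i, Suc j) \<in> vertices P" "(Suc i, j) \<in> vertices P"
    by (auto simp: cell_vertices_def upper_left_def lower_right_def)
qed

text \<open>The corner cells of the rectangle already supply the two endpoints as vertices, so in
  coordinates only the cells remain to be checked.\<close>

lemma inner_interval_iff:
  "inner_interval P (i, j) (k, l) \<longleftrightarrow>
    i < k \<and> j < l \<and> (\<forall>p q. i \<le> p \<longrightarrow> p < k \<longrightarrow> j \<le> q \<longrightarrow> q < l \<longrightarrow> cell (p, q) \<in> P)"
proof -
  have "(i, j) \<in> vertices P \<and> (k, l) \<in> vertices P"
    if "i < k" "j < l" "\<And>p q. i \<le> p \<Longrightarrow> p < k \<Longrightarrow> j \<le> q \<Longrightarrow> q < l \<Longrightarrow> cell (p, q) \<in> P"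
    using vertices_cellI(1)[OF that(3)[of i j]] vertices_cellI(2)[OF that(3)[of "k - 1" "l - 1"]] that(1,2)
    by simp
  then show ?thesis
    unfolding inner_interval_def proper_def cell_subset_iff
    by (auto simp: less_eq_prod_def Suc_le_eq)
qed

lemma inner_interval_antidiagonal_vertices:
  assumes "inner_interval P a b"
  shows "upper_left a b \<in> vertices P" "lower_right a b \<in> vertices P"
proof -
  obtain i j k l where [simp]: "a = (i, j)" "b = (k, l)"
    by (cases a, cases b)
  have ij: "i < k" "j < l" and "cell (i, l - 1) \<in> P" "cell (k - 1, j) \<in> P"
    using assms by (auto simp: inner_interval_iff)
  then show "upper_left a b \<in> vertices P" "lower_right a b \<in> vertices P"
    using vertices_cellI(3)[of i "l - 1" P] vertices_cellI(4)[of "k - 1" j P]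
    by (simp_all add: upper_left_def lower_right_def)
qed

lemma has_cell_with_lower_right_Suc:
  "has_cell_with_lower_right P (Suc i, j) \<longleftrightarrow> cell (i, j) \<in> P"
  unfolding has_cell_with_lower_right_def lower_right_def by (auto split: prod.split)

lemma has_cell_with_upper_left_Suc:
  "has_cell_with_upper_left P (i, Suc j) \<longleftrightarrow> cell (i, j) \<in> P"
  unfolding has_cell_with_upper_left_def upper_left_def by (auto split: prod.split)

lemma thinD:
  assumes "thin P" "cell (i, j) \<in> P" "cell (Suc i, j) \<in> P" "cell (i, Suc j) \<in> P"
  shows "cell (Suc i, Suc j) \<notin> P"
proof -
  have "\<not> {cell (i, j), cell ((i, j) + (1, 0)), cell ((i, j) + (0, 1)), cell ((i, j) + (1, 1))} \<subseteq> P"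
    using assms(1) unfolding thin_def by blast
  then show ?thesis
    using assms by simp
qed

text \<open>Finiteness stops the run on the right. On the left it may reach 0, hence the
  disjunction. It serves for the rows and the columns of cells alike.\<close>

lemma finite_maximal_run:
  fixes R :: "nat \<Rightarrow> bool"
  assumes "finite {p. R p}" "R q"
  obtains s t where "s \<le> q" "q < t" "\<And>p. s \<le> p \<Longrightarrow> p < t \<Longrightarrow> R p"
    "\<not> R t" "s = 0 \<or> \<not> R (s - 1)"
proof -
  define s where "s = (LEAST s. s \<le> q \<and> (\<forall>p. s \<le> p \<longrightarrow> p \<le> q \<longrightarrow> R p))"
  have s: "s \<le> q \<and> (\<forall>p. s \<le> p \<longrightarrow> p \<le> q \<longrightarrow> R p)"
    unfolding s_def by (rule LeastI[of _ q]) (use assms in auto)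
  have "\<exists>t. q < t \<and> \<not> R t"
  proof (rule ccontr)
    assume "\<nexists>t. q < t \<and> \<not> R t"
    then have "{q<..} \<subseteq> {p. R p}" by auto
    then have "finite {q<..}"
      using assms(1) by (rule finite_subset)
    then show False
      by (simp add: infinite_Ioi)
  qed
  then have ex: "\<exists>t. q < t \<and> \<not> R t" .
  define t where "t = (LEAST t. q < t \<and> \<not> R t)"
  have t: "q < t \<and> \<not> R t"
    unfolding t_def using ex by (rule LeastI_ex)
  have run: "R p" if "s \<le> p" "p < t" for p
  proof (cases "q < p")
    case True
    then show ?thesis
      using not_less_Least[of p "\<lambda>t. q < t \<and> \<not> R t"] that(2) unfolding t_def by blast
  next
    case False
    then show ?thesis
      using s that(1) by simp
  qed
  have left: "s = 0 \<or> \<not> R (s - 1)"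
  proof (rule ccontr)
    assume *: "\<not> (s = 0 \<or> \<not> R (s - 1))"
    have "R p" if "s - 1 \<le> p" "p \<le> q" for p
    proof (cases "p = s - 1")
      case True
      then show ?thesis using * by simp
    next
      case False
      then show ?thesis using s that by simp
    qed
    then have "s - 1 \<le> q \<and> (\<forall>p. s - 1 \<le> p \<longrightarrow> p \<le> q \<longrightarrow> R p)"
      using s by auto
    then have "s \<le> s - 1"
      unfolding s_def by (rule Least_le)
    then show False using * by (cases s) auto
  qed
  show ?thesis
    by (rule that[of s t]) (use s t run left in simp_all)
qed


section \<open>Weights on cells\<close>

text \<open>A weight function \<open>w\<close> on cells is indexed by the upper right vertex of the cell, so that
  the weights of all four cells at a vertex are available without truncated subtraction.\<close>

definition cell_weight :: "point set set \<Rightarrow> (nat \<Rightarrow> nat \<Rightarrow> int) \<Rightarrow> bool"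
  where "cell_weight P w \<longleftrightarrow>
    (\<forall>i. w i 0 = 0) \<and> (\<forall>j. w 0 j = 0) \<and> (\<forall>i j. cell (i, j) \<notin> P \<longrightarrow> w (Suc i) (Suc j) = 0)"

text \<open>Coefficient at a vertex of the sum of \<open>w C\<close> times the exponent vector of the binomial
  of the cell \<open>C\<close>.\<close>

definition mixed_difference :: "(nat \<Rightarrow> nat \<Rightarrow> int) \<Rightarrow> point \<Rightarrow> int"
  where "mixed_difference w v =
    w (Suc (fst v)) (Suc (snd v)) + w (fst v) (snd v)
      - w (Suc (fst v)) (snd v) - w (fst v) (Suc (snd v))"

lemma mixed_difference_transpose:
  "mixed_difference (\<lambda>i j. w j i) (p, q) = mixed_difference w (q, p)"
  by (simp add: mixed_difference_def)

lemma mixed_difference_uminus: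
  "mixed_difference (\<lambda>i j. - w i j) v = - mixed_difference w v"
  by (simp add: mixed_difference_def)

lemma cell_weight_uminus: "cell_weight P w \<Longrightarrow> cell_weight P (\<lambda>i j. - w i j)"
  by (simp add: cell_weight_def)

lemma cell_weight_diff:
  "cell_weight P w \<Longrightarrow> cell_weight P w' \<Longrightarrow> cell_weight P (\<lambda>i j. w i j - w' i j)"
  by (simp add: cell_weight_def)

text \<open>The mixed difference is a horizontal difference of vertical differences, so the sum
  telescopes.\<close>

lemma sum_mixed_difference:
  assumes "s \<le> t"
  shows "(\<Sum>p = s..<t. mixed_difference w (p, q)) = (w t (Suc q) - w t q) - (w s (Suc q) - w s q)"
proof -
  have "(\<Sum>p = s..<t. mixed_difference w (p, q)) =
      (\<Sum>p = s..<t. (w (Suc p) (Suc q) - w (Suc p) q) - (w p (Suc q) - w p q))"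
    by (simp add: mixed_difference_def algebra_simps)
  then show ?thesis
    using sum_Suc_diff'[OF assms, of "\<lambda>p. w p (Suc q) - w p q"] by simp
qed

text \<open>Summing the mixed difference over the part of the top side left of a cell, and over the
  part of the bottom side right of it, leaves the difference of weights of the cell and of
  its upper (lower) neighbour; the boundary terms vanish by assumption.\<close>

lemma row_negative_antidiagonal:
  assumes "s \<le> q" "q < t"
    and "w s (Suc j) = 0" "w s (Suc (Suc j)) = 0" "w (Suc t) (Suc j) = 0" "w (Suc t) j = 0"
    and "w (Suc q) (Suc (Suc j)) < w (Suc q) (Suc j)" "w (Suc q) j < w (Suc q) (Suc j)"
  obtains p p' where "s \<le> p" "p \<le> q" "q < p'" "p' \<le> t"
    "mixed_difference w (p, Suc j) < 0" "mixed_difference w (p', j) < 0"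
proof -
  have "(\<Sum>p = s..<Suc q. mixed_difference w (p, Suc j)) < 0"
    by (subst sum_mixed_difference) (use assms in auto)
  then obtain p where p: "p \<in> {s..<Suc q}" "mixed_difference w (p, Suc j) < 0"
    using sum_nonneg[of "{s..<Suc q}" "\<lambda>p. mixed_difference w (p, Suc j)"] by force
  have "(\<Sum>p = Suc q..<Suc t. mixed_difference w (p, j)) < 0"
    by (subst sum_mixed_difference) (use assms in auto)
  then obtain p' where p': "p' \<in> {Suc q..<Suc t}" "mixed_difference w (p', j) < 0"
    using sum_nonneg[of "{Suc q..<Suc t}" "\<lambda>p. mixed_difference w (p, j)"] by force
  show ?thesis
    using that[of p p'] p p' by simp
qed


section \<open>Uniqueness of irreducible monomials\<close>

text \<open>This is divisibility by the product of the two antidiagonal variables, the initial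
  monomial of the binomial by \<open>initial_interval_binomial\<close>. The two vertices are
  distinct, so nonzero exponents suffice.\<close>

definition reducible :: "point set set \<Rightarrow> point monomial \<Rightarrow> bool"
  where "reducible P m \<longleftrightarrow> (\<exists>a b. inner_interval P a b \<and>
    Poly_Mapping.lookup m (upper_left a b) \<noteq> 0 \<and> Poly_Mapping.lookup m (lower_right a b) \<noteq> 0)"

locale thin_collection =
  fixes P :: "point set set"
  assumes finite: "finite P"
    and thin: "thin P"
    and vertical_corners: "\<And>i1 j1 j2. j1 < j2 \<Longrightarrow> maximal_inner_interval P (i1, j1) (Suc i1, j2) \<Longrightarrow>
          \<not> has_cell_with_lower_right P (i1, j2) \<and> \<not> has_cell_with_upper_left P (Suc i1, j1)"
    and horizontal_corners: "\<And>i1 i2 j1. i1 < i2 \<Longrightarrow> maximal_inner_interval P (i1, j1) (i2, Suc j1) \<Longrightarrow>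
          \<not> has_cell_with_lower_right P (i1, Suc j1) \<and> \<not> has_cell_with_upper_left P (i2, j1)"
begin

section \<open>Maximal inner intervals of width one\<close>

lemma finite_row: "finite {p. cell (p, j) \<in> P}"
  using finite_vimageI[OF finite, of "\<lambda>p. cell (p, j)"] inj_cell by (simp add: vimage_def inj_def)

lemma finite_column: "finite {p. cell (i, p) \<in> P}"
  using finite_vimageI[OF finite, of "\<lambda>p. cell (i, p)"] inj_cell by (simp add: vimage_def inj_def)

text \<open>A larger inner interval cannot extend the run sideways, so it contains cells directly
  above or below the row. Over a run of two or more cells this creates a 2 x 2 square, against
  thinness; over a single cell it is excluded by \<open>single\<close>.\<close>

lemma maximal_inner_interval_row:
  assumes "s < t" and row: "\<And>p. s \<le> p \<Longrightarrow> p < t \<Longrightarrow> cell (p, j) \<in> P"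
    and right: "cell (t, j) \<notin> P" and left: "s = 0 \<or> cell (s - 1, j) \<notin> P"
    and single: "Suc s < t \<or> cell (s, Suc j) \<notin> P \<and> (j = 0 \<or> cell (s, j - 1) \<notin> P)"
  shows "maximal_inner_interval P (s, j) (t, Suc j)"
  unfolding maximal_inner_interval_def
proof (intro conjI allI impI notI)
  show "inner_interval P (s, j) (t, Suc j)"
    using assms by (auto simp: inner_interval_iff less_Suc_eq_le)
  fix c d :: point
  assume cd: "inner_interval P c d" and sub: "{(s, j)..(t, Suc j)} \<subset> {c..d}"
  obtain i j' k l where [simp]: "c = (i, j')" "d = (k, l)"
    by (cases c, cases d)
  have "(s, j) \<in> {c..d}" "(t, Suc j) \<in> {c..d}"
    using sub \<open>s < t\<close> by (auto simp: less_eq_prod_def)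
  then have le: "i \<le> s" "j' \<le> j" "t \<le> k" "Suc j \<le> l"
    by (auto simp: less_eq_prod_def)
  have P: "cell (p, q) \<in> P" if "i \<le> p" "p < k" "j' \<le> q" "q < l" for p q
    using cd that by (simp add: inner_interval_iff)
  have "i = s"
  proof (rule ccontr)
    assume "i \<noteq> s"
    then have "s \<noteq> 0" "cell (s - 1, j) \<in> P"
      using le \<open>s < t\<close> by (auto intro!: P)
    then show False using left by simp
  qed
  moreover have "k = t"
  proof (rule ccontr)
    assume "k \<noteq> t"
    then have "cell (t, j) \<in> P"
      using le \<open>s < t\<close> by (intro P) auto
    then show False using right by simp
  qed
  moreover have "j' = j"
  proof (rule ccontr)
    assume "j' \<noteq> j"
    then obtain j0 where j0: "j = Suc j0" "j' \<le> j0"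
      using le by (cases j) auto
    then have "cell (s, j0) \<in> P"
      using le \<open>s < t\<close> by (intro P) auto
    then have "Suc s < t" using single j0 by auto
    then have "cell (s, Suc j0) \<in> P" "cell (Suc s, j0) \<in> P" "cell (Suc s, Suc j0) \<in> P"
      using le j0 by (auto intro!: P)
    then show False
      using thinD[OF thin \<open>cell (s, j0) \<in> P\<close>] by simp
  qed
  moreover have "l = Suc j"
  proof (rule ccontr)
    assume "l \<noteq> Suc j"
    then have "Suc j < l" using le by simp
    then have "cell (s, Suc j) \<in> P"
      using le \<open>s < t\<close> by (intro P) auto
    then have "Suc s < t" using single by auto
    then have "cell (s, j) \<in> P" "cell (Suc s, j) \<in> P" "cell (Suc s, Suc j) \<in> P"
      using le \<open>Suc j < l\<close> by (auto intro!: P)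
    then show False
      using thinD[OF thin \<open>cell (s, j) \<in> P\<close>] \<open>cell (s, Suc j) \<in> P\<close> by simp
  qed
  ultimately show False using sub by simp
qed

text \<open>The argument for rows with the coordinates exchanged.\<close>

lemma maximal_inner_interval_column:
  assumes "s < t" and column: "\<And>p. s \<le> p \<Longrightarrow> p < t \<Longrightarrow> cell (i, p) \<in> P"
    and up: "cell (i, t) \<notin> P" and down: "s = 0 \<or> cell (i, s - 1) \<notin> P"
    and single: "Suc s < t \<or> cell (Suc i, s) \<notin> P \<and> (i = 0 \<or> cell (i - 1, s) \<notin> P)"
  shows "maximal_inner_interval P (i, s) (Suc i, t)"
  unfolding maximal_inner_interval_def
proof (intro conjI allI impI notI)
  show "inner_interval P (i, s) (Suc i, t)"
    using assms by (auto simp: inner_interval_iff less_Suc_eq_le)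
  fix c d :: point
  assume cd: "inner_interval P c d" and sub: "{(i, s)..(Suc i, t)} \<subset> {c..d}"
  obtain i' j k l where [simp]: "c = (i', j)" "d = (k, l)"
    by (cases c, cases d)
  have "(i, s) \<in> {c..d}" "(Suc i, t) \<in> {c..d}"
    using sub \<open>s < t\<close> by (auto simp: less_eq_prod_def)
  then have le: "i' \<le> i" "j \<le> s" "Suc i \<le> k" "t \<le> l"
    by (auto simp: less_eq_prod_def)
  have P: "cell (p, q) \<in> P" if "i' \<le> p" "p < k" "j \<le> q" "q < l" for p q
    using cd that by (simp add: inner_interval_iff)
  have "j = s"
  proof (rule ccontr)
    assume "j \<noteq> s"
    then have "s \<noteq> 0" "cell (i, s - 1) \<in> P"
      using le \<open>s < t\<close> by (auto intro!: P)
    then show False using down by simp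
  qed
  moreover have "l = t"
  proof (rule ccontr)
    assume "l \<noteq> t"
    then have "cell (i, t) \<in> P"
      using le \<open>s < t\<close> by (intro P) auto
    then show False using up by simp
  qed
  moreover have "i' = i"
  proof (rule ccontr)
    assume "i' \<noteq> i"
    then obtain i0 where i0: "i = Suc i0" "i' \<le> i0"
      using le by (cases i) auto
    then have "cell (i0, s) \<in> P"
      using le \<open>s < t\<close> by (intro P) auto
    then have "Suc s < t" using single i0 by auto
    then have "cell (Suc i0, s) \<in> P" "cell (i0, Suc s) \<in> P" "cell (Suc i0, Suc s) \<in> P"
      using le i0 by (auto intro!: P)
    then show False
      using thinD[OF thin \<open>cell (i0, s) \<in> P\<close>] by simp
  qed
  moreover have "k = Suc i"
  proof (rule ccontr)
    assume "k \<noteq> Suc i"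
    then have "Suc i < k" using le by simp
    then have "cell (Suc i, s) \<in> P"
      using le \<open>s < t\<close> by (intro P) auto
    then have "Suc s < t" using single by auto
    then have "cell (i, s) \<in> P" "cell (i, Suc s) \<in> P" "cell (Suc i, Suc s) \<in> P"
      using le \<open>Suc i < k\<close> by (auto intro!: P)
    then show False
      using thinD[OF thin \<open>cell (i, s) \<in> P\<close>] \<open>cell (Suc i, s) \<in> P\<close> by simp
  qed
  ultimately show False using sub by simp
qed

section \<open>Weights of neighbouring cells\<close>

text \<open>If both vertical neighbours had smaller weight, the mixed difference would be negative
  somewhere on the top side left of the cell and on the bottom side right of it, making
  \<open>n\<close> reducible. The hypothesis \<open>single\<close> ensures that the row of the cell
  is a maximal inner interval, so that the corner conditions apply.\<close>

lemma weight_le_vertical_neighbour: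
  assumes w: "cell_weight P w" and irr: "\<not> reducible P n"
    and neg: "\<And>v. mixed_difference w v < 0 \<Longrightarrow> Poly_Mapping.lookup n v \<noteq> 0"
    and C: "cell (q, j) \<in> P"
    and single: "cell (Suc q, j) \<in> P \<or> (q > 0 \<and> cell (q - 1, j) \<in> P) \<or>
      cell (q, Suc j) \<notin> P \<and> (j = 0 \<or> cell (q, j - 1) \<notin> P)"
  shows "w (Suc q) (Suc j) \<le> w (Suc q) (Suc (Suc j)) \<or> w (Suc q) (Suc j) \<le> w (Suc q) j"
proof (rule ccontr)
  assume less: "\<not> ?thesis"
  obtain s t where st: "s \<le> q" "q < t" and row: "\<And>p. s \<le> p \<Longrightarrow> p < t \<Longrightarrow> cell (p, j) \<in> P"
    and right: "cell (t, j) \<notin> P" and left: "s = 0 \<or> cell (s - 1, j) \<notin> P"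
    by (rule finite_maximal_run[of "\<lambda>p. cell (p, j) \<in> P" q, OF finite_row C]) (rule that)
  have "Suc s < t \<or> cell (s, Suc j) \<notin> P \<and> (j = 0 \<or> cell (s, j - 1) \<notin> P)"
  proof (cases "Suc s < t")
    case False
    then have "s = q" "t = Suc q" using st by auto
    then show ?thesis using single right left by auto
  qed simp
  then have max: "maximal_inner_interval P (s, j) (t, Suc j)"
    using st row right left by (intro maximal_inner_interval_row) auto
  have lr: "\<not> has_cell_with_lower_right P (s, Suc j)" and ul: "\<not> has_cell_with_upper_left P (t, j)"
    using horizontal_corners[OF _ max] st by auto
  \<comment> \<open>These are the weights of the cells \<open>(s - 1, j)\<close> and
    \<open>(s - 1, Suc j)\<close>. The first lies beyond the run; the second has lower-right vertex
    \<open>(s, Suc j)\<close>. For \<open>s = 0\<close> both vanish by convention.\<close>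
  have start: "w s (Suc j) = 0" "w s (Suc (Suc j)) = 0"
    using w left lr by (cases s; simp add: cell_weight_def has_cell_with_lower_right_Suc)+
  have stop: "w (Suc t) (Suc j) = 0"
    using w right by (simp add: cell_weight_def)
  \<comment> \<open>The cell in question is \<open>(t, j - 1)\<close>, whose upper-left vertex is
    \<open>(t, j)\<close>.\<close>
  have stop': "w (Suc t) j = 0"
    using w ul by (cases j; simp add: cell_weight_def has_cell_with_upper_left_Suc)
  have "w (Suc q) (Suc (Suc j)) < w (Suc q) (Suc j)" "w (Suc q) j < w (Suc q) (Suc j)"
    using less by auto
  then obtain p p' where pp': "s \<le> p" "p \<le> q" "q < p'" "p' \<le> t"
    "mixed_difference w (p, Suc j) < 0" "mixed_difference w (p', j) < 0"
    by (rule row_negative_antidiagonal[OF st start stop stop']) (rule that)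
  \<comment> \<open>From \<open>p \<le> q < p'\<close> the interval is proper, and its antidiagonal
    vertices are the two points found.\<close>
  then have "inner_interval P (p, j) (p', Suc j)"
    using row by (auto simp: inner_interval_iff less_Suc_eq_le)
  then have "reducible P n"
    unfolding reducible_def using neg pp'(5,6)
    by (intro exI[of _ "(p, j)"] exI[of _ "(p', Suc j)"]) (simp add: upper_left_def lower_right_def)
  then show False using irr by simp
qed

lemma weight_le_horizontal_neighbour:
  assumes w: "cell_weight P w" and irr: "\<not> reducible P n"
    and neg: "\<And>v. mixed_difference w v < 0 \<Longrightarrow> Poly_Mapping.lookup n v \<noteq> 0"
    and C: "cell (i, q) \<in> P"
    and single: "cell (i, Suc q) \<in> P \<or> (q > 0 \<and> cell (i, q - 1) \<in> P) \<or>
      cell (Suc i, q) \<notin> P \<and> (i = 0 \<or> cell (i - 1, q) \<notin> P)"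
  shows "w (Suc i) (Suc q) \<le> w (Suc (Suc i)) (Suc q) \<or> w (Suc i) (Suc q) \<le> w i (Suc q)"
proof (rule ccontr)
  assume less: "\<not> ?thesis"
  obtain s t where st: "s \<le> q" "q < t" and column: "\<And>p. s \<le> p \<Longrightarrow> p < t \<Longrightarrow> cell (i, p) \<in> P"
    and up: "cell (i, t) \<notin> P" and down: "s = 0 \<or> cell (i, s - 1) \<notin> P"
    by (rule finite_maximal_run[of "\<lambda>p. cell (i, p) \<in> P" q, OF finite_column C]) (rule that)
  have "Suc s < t \<or> cell (Suc i, s) \<notin> P \<and> (i = 0 \<or> cell (i - 1, s) \<notin> P)"
  proof (cases "Suc s < t")
    case False
    then have "s = q" "t = Suc q" using st by auto
    then show ?thesis using single up down by auto
  qed simp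
  then have max: "maximal_inner_interval P (i, s) (Suc i, t)"
    using st column up down by (intro maximal_inner_interval_column) auto
  have lr: "\<not> has_cell_with_lower_right P (i, t)" and ul: "\<not> has_cell_with_upper_left P (Suc i, s)"
    using vertical_corners[OF _ max] st by auto
  have start: "w (Suc i) s = 0" "w (Suc (Suc i)) s = 0"
    using w down ul by (cases s; simp add: cell_weight_def has_cell_with_upper_left_Suc)+
  have stop: "w (Suc i) (Suc t) = 0"
    using w up by (simp add: cell_weight_def)
  have stop': "w i (Suc t) = 0"
    using w lr by (cases i; simp add: cell_weight_def has_cell_with_lower_right_Suc)
  have "w (Suc (Suc i)) (Suc q) < w (Suc i) (Suc q)" "w i (Suc q) < w (Suc i) (Suc q)"
    using less by auto
  \<comment> \<open>The row statement is applied to the transposed weight. Transposition exchanges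
    upper-left and lower-right vertices, so antidiagonal pairs stay antidiagonal.\<close>
  then obtain p p' where pp': "s \<le> p" "p \<le> q" "q < p'" "p' \<le> t"
    "mixed_difference w (Suc i, p) < 0" "mixed_difference w (i, p') < 0"
    by (rule row_negative_antidiagonal[of s q t "\<lambda>x y. w y x" i,
          unfolded mixed_difference_transpose[of w], OF st start stop stop']) (rule that)
  then have "inner_interval P (i, p) (Suc i, p')"
    using column by (auto simp: inner_interval_iff less_Suc_eq_le)
  then have "reducible P n"
    unfolding reducible_def using neg pp'(5,6)
    by (intro exI[of _ "(i, p)"] exI[of _ "(Suc i, p')"]) (simp add: upper_left_def lower_right_def)
  then show False using irr by simp
qed

text \<open>The bound is one-sided so that it can be applied both to \<open>w\<close> and to
  \<open>- w\<close>. A positive maximum would spread over a 2 x 2 square of cells.\<close>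

lemma weight_nonpos:
  assumes w: "cell_weight P w" and irr: "\<not> reducible P n"
    and neg: "\<And>v. mixed_difference w v < 0 \<Longrightarrow> Poly_Mapping.lookup n v \<noteq> 0"
  shows "w x y \<le> 0"
proof (rule ccontr)
  assume pos: "\<not> w x y \<le> 0"
  define A where "A = {v. cell v \<in> P}"
  define f where "f v = w (Suc (fst v)) (Suc (snd v))" for v :: point
  define L where "L = Max (f ` A)"
  have fin: "finite (f ` A)"
    using finite_vimageI[OF finite inj_cell] by (simp add: A_def vimage_def)
  have supp: "\<exists>i j. x = Suc i \<and> y = Suc j \<and> (i, j) \<in> A \<and> f (i, j) = w x y" if "w x y \<noteq> 0" for x y
    using w that by (cases x; cases y) (auto simp: cell_weight_def A_def f_def)
  have f_le: "f v \<le> L" if "v \<in> A" for v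
    unfolding L_def using fin that by (intro Max_ge) auto
  have "L \<ge> w x y"
    using supp[of x y] pos f_le by (metis order_refl)
  then have L: "L > 0" using pos by simp
  have w_le: "w x y \<le> L" for x y
  proof (cases "w x y = 0")
    case False
    then show ?thesis
      using supp[of x y] f_le by metis
  qed (use L in simp)
  have "A \<noteq> {}" using supp[of x y] pos by auto
  then have "L \<in> f ` A" using fin by (auto simp: L_def intro!: Max_in)
  define T where "T i j \<longleftrightarrow> w (Suc i) (Suc j) = L" for i j
  have T_cell: "cell (i, j) \<in> P" if "T i j" for i j
    using that L supp[of "Suc i" "Suc j"] by (auto simp: T_def A_def)
  \<comment> \<open>A missing neighbour has weight 0, which is less than \<open>L\<close>. So a
    neighbour of weight at least \<open>L\<close> is a cell, and its weight is exactly
    \<open>L\<close>.\<close>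
  have vertical: "T i (Suc j) \<or> j > 0 \<and> T i (j - 1)"
    if "T i j" "cell (Suc i, j) \<in> P \<or> (i > 0 \<and> cell (i - 1, j) \<in> P)" for i j
  proof -
    have "L \<le> w (Suc i) (Suc (Suc j)) \<or> L \<le> w (Suc i) j"
      using weight_le_vertical_neighbour[OF w irr neg T_cell[OF that(1)]] that by (auto simp: T_def)
    then show ?thesis
      using w_le[of "Suc i" "Suc (Suc j)"] w_le[of "Suc i" j] L w
      by (cases j) (auto simp: T_def cell_weight_def)
  qed
  have horizontal: "T (Suc i) j \<or> i > 0 \<and> T (i - 1) j"
    if "T i j" "cell (i, Suc j) \<in> P \<or> (j > 0 \<and> cell (i, j - 1) \<in> P) \<or>
      cell (Suc i, j) \<notin> P \<and> (i = 0 \<or> cell (i - 1, j) \<notin> P)" for i j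
  proof -
    have "L \<le> w (Suc (Suc i)) (Suc j) \<or> L \<le> w i (Suc j)"
      using weight_le_horizontal_neighbour[OF w irr neg T_cell[OF that(1)] that(2)] that(1)
      by (simp add: T_def)
    then show ?thesis
      using w_le[of "Suc (Suc i)" "Suc j"] w_le[of i "Suc j"] L w
      by (cases i) (auto simp: T_def cell_weight_def)
  qed
  \<comment> \<open>Without a horizontal neighbour the column through the cell is a maximal
    interval, and \<open>horizontal\<close> would produce a horizontal neighbour after all.\<close>
  have vertical': "T i (Suc j) \<or> j > 0 \<and> T i (j - 1)" if "T i j" for i j
  proof (cases "cell (Suc i, j) \<in> P \<or> i > 0 \<and> cell (i - 1, j) \<in> P")
    case True
    then show ?thesis by (rule vertical[OF that])
  next
    case False
    then have "T (Suc i) j \<or> i > 0 \<and> T (i - 1) j"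
      by (intro horizontal[OF that]) auto
    then show ?thesis using False T_cell by blast
  qed
  \<comment> \<open>The vertical neighbour just obtained satisfies the side condition of
    \<open>horizontal\<close>.\<close>
  have horizontal': "T (Suc i) j \<or> i > 0 \<and> T (i - 1) j" if "T i j" for i j
    by (rule horizontal[OF that]) (use vertical'[OF that] T_cell in blast)
  define i where "i = (LEAST i. \<exists>j. T i j)"
  define j where "j = (LEAST j. T i j)"
  have "\<exists>i j. T i j"
    using \<open>L \<in> f ` A\<close> by (auto simp: T_def f_def)
  then have "\<exists>j. T i j"
    unfolding i_def by (rule LeastI_ex)
  then have ij: "T i j"
    unfolding j_def by (rule LeastI_ex)
  \<comment> \<open>The column \<open>i\<close> is leftmost over all rows, so this also applies to
    the cell \<open>(i, Suc j)\<close>, whose horizontal neighbour completes the square.\<close>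
  have left: "\<not> (i > 0 \<and> T (i - 1) j')" for j'
  proof
    assume *: "i > 0 \<and> T (i - 1) j'"
    then have "\<exists>j. T (i - 1) j" by blast
    then have "i \<le> i - 1"
      unfolding i_def by (rule Least_le)
    then show False using * by (cases i) auto
  qed
  have down: "\<not> (j > 0 \<and> T i (j - 1))"
  proof
    assume *: "j > 0 \<and> T i (j - 1)"
    then have "T i (j - 1)" by blast
    then have "j \<le> j - 1"
      unfolding j_def by (rule Least_le)
    then show False using * by (cases j) auto
  qed
  have "T i (Suc j)" using vertical'[OF ij] down by blast
  moreover have "T (Suc i) j" using horizontal'[OF ij] left by blast
  moreover have "T (Suc i) (Suc j)" using horizontal'[OF \<open>T i (Suc j)\<close>] left by blast
  ultimately show False
    using thinD[OF thin] ij T_cell by blast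
qed

text \<open>Exchanging \<open>m\<close> and \<open>n\<close> replaces \<open>w\<close> by
  \<open>- w\<close>, so both signs of the weight are excluded.\<close>

lemma irreducible_unique:
  assumes w: "cell_weight P w" and irr: "\<not> reducible P m" "\<not> reducible P n"
    and diff: "\<And>v. int (Poly_Mapping.lookup m v) - int (Poly_Mapping.lookup n v) = mixed_difference w v"
  shows "m = n"
proof -
  have upper: "w i j \<le> 0" for i j
  proof (rule weight_nonpos[OF w irr(2)])
    \<comment> \<open>Exponents of \<open>m\<close> are nonnegative, so a negative difference needs
      a positive exponent of \<open>n\<close>.\<close>
    show "Poly_Mapping.lookup n v \<noteq> 0" if "mixed_difference w v < 0" for v
      using that diff[of v] by linarith
  qed
  have lower: "- w i j \<le> 0" for i j
  proof (rule weight_nonpos[OF cell_weight_uminus[OF w] irr(1)])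
    show "Poly_Mapping.lookup m v \<noteq> 0" if "mixed_difference (\<lambda>i j. - w i j) v < 0" for v
      using that diff[of v] unfolding mixed_difference_uminus by linarith
  qed
  have "w i j = 0" for i j
    using upper[of i j] lower[of i j] by linarith
  then have "mixed_difference w v = 0" for v
    by (simp add: mixed_difference_def)
  then show ?thesis
    using diff by (intro poly_mapping_eqI) simp
qed

end


section \<open>Polynomial rings\<close>

lemma cring_mpoly_ring: "cring (mpoly_ring V :: ('v, 'k::field) mpoly ring)"
proof (rule cringI)
  show "abelian_group (mpoly_ring V :: ('v, 'k) mpoly ring)"
  proof (rule abelian_groupI)
    fix x :: "('v, 'k) mpoly"
    assume "x \<in> carrier (mpoly_ring V)"
    then show "\<exists>y\<in>carrier (mpoly_ring V). y \<oplus>\<^bsub>mpoly_ring V\<^esub> x = \<zero>\<^bsub>mpoly_ring V\<^esub>"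
      by (intro bexI[of _ "- x"]) (auto simp: mpoly_ring_def)
  next
    fix x y :: "('v, 'k) mpoly"
    assume "x \<in> carrier (mpoly_ring V)" "y \<in> carrier (mpoly_ring V)"
    then show "x \<oplus>\<^bsub>mpoly_ring V\<^esub> y \<in> carrier (mpoly_ring V)"
      using Poly_Mapping.keys_add[of x y] by (fastforce simp: mpoly_ring_def)
  qed (auto simp: mpoly_ring_def add_ac)
  show "comm_monoid (mpoly_ring V :: ('v, 'k) mpoly ring)"
  proof (rule comm_monoidI)
    fix x y :: "('v, 'k) mpoly"
    assume xy: "x \<in> carrier (mpoly_ring V)" "y \<in> carrier (mpoly_ring V)"
    have "Poly_Mapping.keys m \<subseteq> V" if m: "m \<in> Poly_Mapping.keys (x * y)" for m
    proof -
      obtain a b where "m = a + b" "a \<in> Poly_Mapping.keys x" "b \<in> Poly_Mapping.keys y"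
        using keys_mult[of x y] m by blast
      moreover have "Poly_Mapping.keys a \<subseteq> V" "Poly_Mapping.keys b \<subseteq> V"
        using xy calculation by (auto simp: mpoly_ring_def)
      ultimately show ?thesis
        using Poly_Mapping.keys_add[of a b] by blast
    qed
    then show "x \<otimes>\<^bsub>mpoly_ring V\<^esub> y \<in> carrier (mpoly_ring V)"
      by (simp add: mpoly_ring_def)
  qed (auto simp: mpoly_ring_def mult_ac)
qed (auto simp: mpoly_ring_def algebra_simps)

lemmas ring_mpoly_ring = cring.axioms(1)[OF cring_mpoly_ring]

lemma single_in_carrier: "Poly_Mapping.keys m \<subseteq> V \<Longrightarrow> Poly_Mapping.single m c \<in> carrier (mpoly_ring V)"
  by (simp add: mpoly_ring_def)

context
  fixes I :: "('v, 'k::field) mpoly set" and V :: "'v set"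
  assumes I: "ideal I (mpoly_ring V)"
begin

lemma ideal_zero: "0 \<in> I"
  using additive_subgroup.zero_closed[OF ideal.axioms(1)[OF I]] by (simp add: mpoly_ring_def)

lemma ideal_add: "f \<in> I \<Longrightarrow> g \<in> I \<Longrightarrow> f + g \<in> I"
  using additive_subgroup.a_closed[OF ideal.axioms(1)[OF I], of f g] by (simp add: mpoly_ring_def)

lemma ideal_sum: "(\<And>x. x \<in> A \<Longrightarrow> f x \<in> I) \<Longrightarrow> sum f A \<in> I"
  by (induction A rule: infinite_finite_induct) (auto intro: ideal_zero ideal_add)

lemma ideal_single_mult:
  "f \<in> I \<Longrightarrow> Poly_Mapping.keys m \<subseteq> V \<Longrightarrow> Poly_Mapping.single m c * f \<in> I"
  using ideal.I_l_closed[OF I, of f "Poly_Mapping.single m c"] single_in_carrier[of m V c]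
  by (simp add: mpoly_ring_def)

end

text \<open>This is the linear extension of a map of exponents. For additive \<open>h\<close> it is
  multiplicative, as a map of monoid algebras.\<close>

definition push_forward :: "('a \<Rightarrow> 'b) \<Rightarrow> ('a \<Rightarrow>\<^sub>0 'k::comm_monoid_add) \<Rightarrow> ('b \<Rightarrow>\<^sub>0 'k)"
  where "push_forward h f =
    (\<Sum>m\<in>Poly_Mapping.keys f. Poly_Mapping.single (h m) (Poly_Mapping.lookup f m))"

lemma push_forward_zero [simp]: "push_forward h 0 = 0"
  by (simp add: push_forward_def)

lemma push_forward_single [simp]:
  "push_forward h (Poly_Mapping.single m c) = Poly_Mapping.single (h m) c"
  by (simp add: push_forward_def)

lemma push_forward_add: "push_forward h (f + g) = push_forward h f + push_forward h g"
  unfolding push_forward_def by (rule setsum_keys_plus_distrib) (simp_all add: single_add)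

lemma push_forward_diff:
  fixes f g :: "'a \<Rightarrow>\<^sub>0 'k::ab_group_add"
  shows "push_forward h (f - g) = push_forward h f - push_forward h g"
  using push_forward_add[of h "f - g" g] by (simp add: algebra_simps)

lemma push_forward_sum: "push_forward h (sum f A) = (\<Sum>x\<in>A. push_forward h (f x))"
  by (induction A rule: infinite_finite_induct) (auto simp: push_forward_add)

lemma sum_single_keys:
  "(\<Sum>m\<in>Poly_Mapping.keys f. Poly_Mapping.single m (Poly_Mapping.lookup f m)) = f"
  by (rule poly_mapping_eqI)
    (simp add: lookup_sum lookup_single when_def sum.delta in_keys_iff)

lemma lookup_push_forward:
  "Poly_Mapping.lookup (push_forward h f) e =
    (\<Sum>m\<in>{m \<in> Poly_Mapping.keys f. h m = e}. Poly_Mapping.lookup f m)"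
  unfolding push_forward_def lookup_sum lookup_single when_def
  by (rule sum.inter_filter[symmetric]) simp

lemma push_forward_mult:
  fixes f g :: "'a::monoid_add \<Rightarrow>\<^sub>0 'k::semiring_0" and h :: "'a \<Rightarrow> 'b::monoid_add"
  assumes h: "\<And>m n. h (m + n) = h m + h n"
  shows "push_forward h (f * g) = push_forward h f * push_forward h g"
proof -
  have "f * g = (\<Sum>m\<in>Poly_Mapping.keys f. Poly_Mapping.single m (Poly_Mapping.lookup f m)) *
      (\<Sum>n\<in>Poly_Mapping.keys g. Poly_Mapping.single n (Poly_Mapping.lookup g n))"
    by (simp only: sum_single_keys)
  then have "push_forward h (f * g) = (\<Sum>m\<in>Poly_Mapping.keys f. \<Sum>n\<in>Poly_Mapping.keys g.
      Poly_Mapping.single (h m + h n) (Poly_Mapping.lookup f m * Poly_Mapping.lookup g n))"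
    by (simp add: sum_product push_forward_sum mult_single h)
  then show ?thesis
    by (simp add: push_forward_def sum_product mult_single)
qed

text \<open>The push-forward is a ring homomorphism, and linearly ordered cancellative exponents
  leave the target ring without zero divisors, so the kernel is prime.\<close>

lemma primeideal_push_forward_kernel:
  fixes h :: "'v monomial \<Rightarrow> 'e::{ordered_cancel_comm_monoid_add, linorder}"
  assumes h: "\<And>m n. h (m + n) = h m + h n" "h 0 = 0"
  shows "primeideal {f \<in> carrier (mpoly_ring V :: ('v, 'k::field) mpoly ring). push_forward h f = 0}
    (mpoly_ring V)"
    (is "primeideal ?J ?R")
proof (rule primeidealI[OF idealI[OF ring_mpoly_ring] cring_mpoly_ring])
  interpret R: cring ?R by (rule cring_mpoly_ring)
  have add: "x \<oplus>\<^bsub>?R\<^esub> y = x + y" and zero: "\<zero>\<^bsub>?R\<^esub> = 0" for x y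
    by (simp_all add: mpoly_ring_def)
  show "subgroup ?J (add_monoid ?R)"
  proof (rule R.add.subgroupI)
    show "?J \<noteq> {}" using R.zero_closed by (auto simp: zero)
  next
    fix f assume f: "f \<in> ?J"
    then have "\<ominus>\<^bsub>?R\<^esub> f + f = 0"
      using R.l_neg[of f] by (simp add: add zero)
    then have "push_forward h (\<ominus>\<^bsub>?R\<^esub> f) = 0"
      using f push_forward_add[of h "\<ominus>\<^bsub>?R\<^esub> f" f] by simp
    then show "\<ominus>\<^bsub>?R\<^esub> f \<in> ?J"
      using f by simp
  next
    fix f g assume "f \<in> ?J" "g \<in> ?J"
    then show "f \<oplus>\<^bsub>?R\<^esub> g \<in> ?J"
      using R.a_closed[of f g] by (simp add: add push_forward_add)
  qed auto
next
  interpret R: cring ?R by (rule cring_mpoly_ring)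
  have mult: "x \<otimes>\<^bsub>?R\<^esub> y = x * y" for x y
    by (simp add: mpoly_ring_def)
  fix f g assume fg: "f \<in> ?J" "g \<in> carrier ?R"
  then show "g \<otimes>\<^bsub>?R\<^esub> f \<in> ?J" "f \<otimes>\<^bsub>?R\<^esub> g \<in> ?J"
    using R.m_closed[of f g] R.m_closed[of g f] by (simp_all add: mult push_forward_mult h(1))
next
  have "1 \<in> carrier ?R"
    by (simp add: mpoly_ring_def)
  moreover have "push_forward h (1 :: ('v, 'k) mpoly) = 1"
    using push_forward_single[of h 0 "1 :: 'k"] by (simp add: h(2))
  ultimately have "1 \<in> carrier ?R - ?J"
    by simp
  then show "carrier ?R \<noteq> ?J"
    by blast
next
  fix f g assume "f \<in> carrier ?R" "g \<in> carrier ?R" "f \<otimes>\<^bsub>?R\<^esub> g \<in> ?J"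
  then show "f \<in> ?J \<or> g \<in> ?J"
    by (simp add: mpoly_ring_def push_forward_mult h(1))
qed


section \<open>The graded reverse lexicographic order\<close>

text \<open>This covers both the degree, with \<open>g\<close> constantly 1, and
  \<open>diagonal_energy\<close>.\<close>

lemma weighted_degree_add:
  fixes g :: "'v \<Rightarrow> nat"
  shows "(\<Sum>a\<in>Poly_Mapping.keys (m + n). Poly_Mapping.lookup (m + n) a * g a) =
    (\<Sum>a\<in>Poly_Mapping.keys m. Poly_Mapping.lookup m a * g a) +
    (\<Sum>a\<in>Poly_Mapping.keys n. Poly_Mapping.lookup n a * g a)"
  by (rule setsum_keys_plus_distrib) (simp_all add: algebra_simps)

lemma mdegree_add: "mdegree (m + n) = mdegree m + mdegree n"
  using weighted_degree_add[of m n "\<lambda>_. 1"] by (simp add: mdegree_def)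

lemma mdegree_single [simp]: "mdegree (Poly_Mapping.single a n) = n"
  by (simp add: mdegree_def)

lemma var_less_linear: "var_less a b \<or> a = b \<or> var_less b a"
  by (cases a; cases b) (auto simp: var_less_def)

lemma var_less_trans: "var_less a b \<Longrightarrow> var_less b c \<Longrightarrow> var_less a c"
  by (auto simp: var_less_def)

lemma wf_var_less: "wf {(a, b). var_less a b}"
proof -
  have "{(a, b). var_less a b} = less_than <*lex*> less_than"
    by (auto simp: var_less_def)
  then show ?thesis by (simp add: wf_lex_prod)
qed

abbreviation point_grevlex :: "point monomial \<Rightarrow> point monomial \<Rightarrow> bool" (infix "\<prec>" 50)
  where "m \<prec> n \<equiv> grevlex var_less m n"

lemma grevlex_irrefl: "\<not> m \<prec> m"
  by (simp add: grevlex_def)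

text \<open>When all degrees agree, the smaller of the two deciding variables decides the comparison
  of \<open>m\<close> and \<open>k\<close>.\<close>

lemma grevlex_trans:
  assumes "m \<prec> n" "n \<prec> k"
  shows "m \<prec> k"
proof (cases "mdegree m = mdegree n \<and> mdegree n = mdegree k")
  case True
  then obtain a b where
    a: "Poly_Mapping.lookup m a > Poly_Mapping.lookup n a"
      "\<And>v. var_less v a \<Longrightarrow> Poly_Mapping.lookup m v = Poly_Mapping.lookup n v" and
    b: "Poly_Mapping.lookup n b > Poly_Mapping.lookup k b"
      "\<And>v. var_less v b \<Longrightarrow> Poly_Mapping.lookup n v = Poly_Mapping.lookup k v"
    using assms by (auto simp: grevlex_def)
  have "\<exists>c. Poly_Mapping.lookup m c > Poly_Mapping.lookup k c \<and>
      (\<forall>v. var_less v c \<longrightarrow> Poly_Mapping.lookup m v = Poly_Mapping.lookup k v)"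
  proof (cases "var_less b a")
    case True
    then show ?thesis
      using a(2)[of b] a(2)[OF var_less_trans[OF _ True]] b by (intro exI[of _ b]) simp
  next
    case False
    then have ab: "a = b \<or> var_less a b" using var_less_linear by blast
    then have "Poly_Mapping.lookup k a \<le> Poly_Mapping.lookup n a"
      using ab b(1) b(2)[of a] by auto
    moreover have "Poly_Mapping.lookup n v = Poly_Mapping.lookup k v" if "var_less v a" for v
      using ab b(2)[of v] var_less_trans[OF that, of b] that by blast
    ultimately show ?thesis
      using a by (intro exI[of _ a]) auto
  qed
  then show ?thesis using True by (simp add: grevlex_def)
next
  case False
  then show ?thesis using assms by (auto simp: grevlex_def)
qed

text \<open>A smallest variable with different exponents exists because \<open>var_less\<close> is
  well-founded.\<close>

lemma grevlex_linear:
  assumes "m \<noteq> n"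
  shows "m \<prec> n \<or> n \<prec> m"
proof (cases "mdegree m = mdegree n")
  case True
  let ?D = "{x. Poly_Mapping.lookup m x \<noteq> Poly_Mapping.lookup n x}"
  obtain x where "x \<in> ?D"
    using assms by (auto simp: poly_mapping_eq_iff fun_eq_iff)
  then obtain a where "a \<in> ?D" "\<And>b. (b, a) \<in> {(a, b). var_less a b} \<Longrightarrow> b \<notin> ?D"
    by (rule wfE_min[OF wf_var_less]) (rule that)
  then have "\<exists>a. Poly_Mapping.lookup m a \<noteq> Poly_Mapping.lookup n a \<and>
      (\<forall>b. var_less b a \<longrightarrow> Poly_Mapping.lookup m b = Poly_Mapping.lookup n b)"
    by blast
  then show ?thesis
    using True unfolding grevlex_def by (metis nat_neq_iff)
qed (auto simp: grevlex_def)

lemma initial_monomial_eqI: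
  assumes "m \<in> Poly_Mapping.keys f" "\<And>n. n \<in> Poly_Mapping.keys f \<Longrightarrow> n \<noteq> m \<Longrightarrow> n \<prec> m"
  shows "initial_monomial (grevlex var_less) f = m"
  unfolding initial_monomial_def
proof (rule the_equality)
  fix m'
  assume m': "m' \<in> Poly_Mapping.keys f \<and> (\<forall>n\<in>Poly_Mapping.keys f. n \<noteq> m' \<longrightarrow> n \<prec> m')"
  show "m' = m"
  proof (rule ccontr)
    assume "m' \<noteq> m"
    then have "m' \<prec> m" "m \<prec> m'" using m' assms by auto
    then show False using grevlex_trans[of m m' m] grevlex_irrefl[of m] by simp
  qed
qed (use assms in simp)

text \<open>Finite support and linearity of the order make the description in
  \<open>initial_monomial\<close> denote.\<close>

lemma initial_monomial_greatest:
  fixes f :: "(point, 'k::field) mpoly"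
  assumes "f \<noteq> 0"
  shows "initial_monomial (grevlex var_less) f \<in> Poly_Mapping.keys f"
    and "n \<in> Poly_Mapping.keys f \<Longrightarrow> n \<noteq> initial_monomial (grevlex var_less) f \<Longrightarrow>
      n \<prec> initial_monomial (grevlex var_less) f"
proof -
  have "\<exists>m\<in>Poly_Mapping.keys f. \<forall>n\<in>Poly_Mapping.keys f. n \<noteq> m \<longrightarrow> \<not> m \<prec> n"
  proof (rule Finite_Set.bex_max_element)
    show "asymp_on (Poly_Mapping.keys f) (\<prec>)"
      by (rule asymp_onI) (use grevlex_trans grevlex_irrefl in metis)
    show "transp_on (Poly_Mapping.keys f) (\<prec>)"
      by (rule transp_onI) (rule grevlex_trans)
  qed (use assms in simp_all)
  then obtain m where m: "m \<in> Poly_Mapping.keys f" "\<And>n. n \<in> Poly_Mapping.keys f \<Longrightarrow> n \<noteq> m \<Longrightarrow> n \<prec> m"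
    using grevlex_linear by blast
  then have "initial_monomial (grevlex var_less) f = m"
    by (rule initial_monomial_eqI)
  with m show "initial_monomial (grevlex var_less) f \<in> Poly_Mapping.keys f"
    and "n \<in> Poly_Mapping.keys f \<Longrightarrow> n \<noteq> initial_monomial (grevlex var_less) f \<Longrightarrow>
      n \<prec> initial_monomial (grevlex var_less) f"
    by simp_all
qed


section \<open>Reduction of monomials\<close>

abbreviation var_pair :: "point \<Rightarrow> point \<Rightarrow> point monomial"
  where "var_pair a b \<equiv> Poly_Mapping.single a 1 + Poly_Mapping.single b 1"

lemma interval_binomial_eq:
  "(interval_binomial a b :: (point, 'k::field) mpoly) =
    Poly_Mapping.single (var_pair a b) 1
      - Poly_Mapping.single (var_pair (upper_left a b) (lower_right a b)) 1"
  by (simp add: interval_binomial_def var_def mult_single)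

lemma interval_binomial_in: "inner_interval P a b \<Longrightarrow> interval_binomial a b \<in> inner_binomials P"
  unfolding inner_binomials_def by blast

text \<open>The lower-left vertex \<open>a\<close> is the smallest of the four variables and occurs
  only in the diagonal product, which is therefore the smaller one.\<close>

lemma grevlex_exchange:
  assumes "proper a b"
  shows "var_pair a b + r \<prec> var_pair (upper_left a b) (lower_right a b) + r"
proof -
  have less: "Poly_Mapping.lookup (var_pair (upper_left a b) (lower_right a b) + r) a <
      Poly_Mapping.lookup (var_pair a b + r) a"
    using assms by (cases a; cases b)
      (simp add: lookup_add lookup_single proper_def upper_left_def lower_right_def when_def)
  have eq: "Poly_Mapping.lookup (var_pair a b + r) v =
      Poly_Mapping.lookup (var_pair (upper_left a b) (lower_right a b) + r) v" if "var_less v a" for v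
    using assms that by (cases a; cases b; cases v)
      (auto simp: lookup_add lookup_single proper_def upper_left_def lower_right_def when_def var_less_def)
  have "mdegree (var_pair a b + r) = mdegree (var_pair (upper_left a b) (lower_right a b) + r)"
    by (simp add: mdegree_add)
  with less eq show ?thesis
    unfolding grevlex_def by blast
qed

lemma initial_interval_binomial:
  assumes "proper a b"
  shows "initial_monomial (grevlex var_less) (interval_binomial a b :: (point, 'k::field) mpoly) =
      var_pair (upper_left a b) (lower_right a b)"
    and "(interval_binomial a b :: (point, 'k) mpoly) \<noteq> 0"
proof -
  let ?f = "interval_binomial a b :: (point, 'k) mpoly"
  let ?m = "var_pair (upper_left a b) (lower_right a b)"
  have less: "var_pair a b \<prec> ?m"
    using grevlex_exchange[OF assms, of 0] by simp
  then have "var_pair a b \<noteq> ?m"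
    using grevlex_irrefl by metis
  then have "Poly_Mapping.lookup ?f ?m = - 1"
    by (simp add: interval_binomial_eq lookup_minus lookup_single when_def)
  then have m: "?m \<in> Poly_Mapping.keys ?f"
    by (simp add: in_keys_iff)
  then show "?f \<noteq> 0" by auto
  have "Poly_Mapping.keys ?f \<subseteq> {var_pair a b, ?m}"
    unfolding interval_binomial_eq using keys_diff by fastforce
  then show "initial_monomial (grevlex var_less) ?f = ?m"
    using m less by (intro initial_monomial_eqI) auto
qed

lemma reducible_split:
  assumes "reducible P m"
  obtains a b r where "inner_interval P a b"
    "m = var_pair (upper_left a b) (lower_right a b) + r" "Poly_Mapping.keys r \<subseteq> Poly_Mapping.keys m"
proof -
  obtain a b where ab: "inner_interval P a b" "Poly_Mapping.lookup m (upper_left a b) \<noteq> 0"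
    "Poly_Mapping.lookup m (lower_right a b) \<noteq> 0"
    using assms by (auto simp: reducible_def)
  \<comment> \<open>Distinct vertices mean that exponent one is removed at each, so the truncated
    subtraction loses nothing.\<close>
  then have "upper_left a b \<noteq> lower_right a b"
    by (auto simp: inner_interval_def proper_def upper_left_def lower_right_def)
  then have "m = var_pair (upper_left a b) (lower_right a b)
      + (m - var_pair (upper_left a b) (lower_right a b))"
    using ab by (intro poly_mapping_eqI) (auto simp: lookup_add lookup_minus lookup_single when_def)
  moreover have "Poly_Mapping.keys (m - var_pair (upper_left a b) (lower_right a b))
      \<subseteq> Poly_Mapping.keys m"
    by (auto simp: in_keys_iff lookup_minus)
  ultimately show ?thesis
    using ab(1) that by blast
qed

text \<open>A termination measure for the reduction: squared distances from the main diagonal, up to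
  scaling. Being a natural number, it permits induction without well-foundedness of the monomial
  order.\<close>

definition diagonal_energy :: "point monomial \<Rightarrow> nat"
  where "diagonal_energy m = (\<Sum>v\<in>Poly_Mapping.keys m.
    Poly_Mapping.lookup m v * nat ((int (fst v) - int (snd v))\<^sup>2))"

lemma diagonal_energy_exchange:
  assumes "proper a b"
  shows "diagonal_energy (var_pair a b + r) <
    diagonal_energy (var_pair (upper_left a b) (lower_right a b) + r)"
proof -
  obtain i j k l where ab [simp]: "a = (i, j)" "b = (k, l)"
    by (cases a, cases b)
  have add: "diagonal_energy (m + n) = diagonal_energy m + diagonal_energy n" for m n
    unfolding diagonal_energy_def by (rule weighted_degree_add)
  \<comment> \<open>The two sums of squares below differ by twice this product.\<close>
  have "0 < (int k - int i) * (int l - int j)"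
    using assms by (simp add: proper_def)
  then have "(int i - int j)\<^sup>2 + (int k - int l)\<^sup>2 < (int i - int l)\<^sup>2 + (int k - int j)\<^sup>2"
    by (simp add: power2_eq_square algebra_simps)
  then have "nat ((int i - int j)\<^sup>2 + (int k - int l)\<^sup>2) <
      nat ((int i - int l)\<^sup>2 + (int k - int j)\<^sup>2)"
    by (subst nat_less_eq_zless) simp_all
  then have "nat ((int i - int j)\<^sup>2) + nat ((int k - int l)\<^sup>2) <
      nat ((int i - int l)\<^sup>2) + nat ((int k - int j)\<^sup>2)"
    by (simp add: nat_add_distrib)
  then show ?thesis
    by (simp add: add) (simp add: diagonal_energy_def upper_left_def lower_right_def)
qed


section \<open>The toric parametrization\<close>

text \<open>The weight \<open>w\<close> for which \<open>x - mixed_difference w\<close> vanishes at the lower left vertices of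
  all cells.\<close>

fun solve :: "point set set \<Rightarrow> (point \<Rightarrow> int) \<Rightarrow> nat \<Rightarrow> nat \<Rightarrow> int" where
  "solve P x 0 j = 0"
| "solve P x (Suc i) 0 = 0"
| "solve P x (Suc i) (Suc j) =
    (if cell (i, j) \<in> P then x (i, j) - solve P x i j + solve P x (Suc i) j + solve P x i (Suc j)
     else 0)"

lemma cell_weight_solve: "cell_weight P (solve P x)"
proof -
  have "solve P x i 0 = 0" for i by (cases i) simp_all
  then show ?thesis by (simp add: cell_weight_def)
qed

lemma solve_add: "solve P (\<lambda>v. x v + y v) i j = solve P x i j + solve P y i j"
  by (induction P x i j rule: solve.induct) simp_all

text \<open>The system is triangular: at the lower left vertex of a cell its own weight has
  coefficient one, and the other three weights are already recovered.\<close>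

lemma solve_mixed_difference:
  shows "cell_weight P w \<Longrightarrow> solve P (mixed_difference w) i j = w i j"
proof (induction P "mixed_difference w" i j rule: solve.induct)
  case (3 P i j)
  moreover have "w (Suc i) (Suc j) = 0" if "cell (i, j) \<notin> P"
    using 3 that unfolding cell_weight_def by blast
  ultimately show ?case
    by (cases "cell (i, j) \<in> P") (simp_all add: mixed_difference_def)
qed (simp_all add: cell_weight_def)

text \<open>An additive map that kills the lattice of mixed differences of cell weights and changes
  a vector only by a lattice element, so it represents the class.\<close>

definition residue :: "point set set \<Rightarrow> (point \<Rightarrow> int) \<Rightarrow> point \<Rightarrow> int"
  where "residue P x v = x v - mixed_difference (solve P x) v"

lemma residue_add: "residue P (\<lambda>v. x v + y v) v = residue P x v + residue P y v"
  by (simp add: residue_def mixed_difference_def solve_add)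

lemma residue_mixed_difference: "cell_weight P w \<Longrightarrow> residue P (mixed_difference w) v = 0"
proof -
  assume "cell_weight P w"
  then have "solve P (mixed_difference w) = w"
    by (intro ext solve_mixed_difference)
  then show ?thesis by (simp add: residue_def)
qed

text \<open>The four weights entering at \<open>v\<close> belong to the cells having
  \<open>v\<close> as a vertex.\<close>

lemma mixed_difference_outside:
  assumes "cell_weight P w" "v \<notin> vertices P"
  shows "mixed_difference w v = 0"
proof -
  obtain i j where [simp]: "v = (i, j)" by (cases v)
  have outside: "cell (p, q) \<notin> P" if "i = p \<or> i = Suc p" "j = q \<or> j = Suc q" for p q
    using that vertices_cellI[of p q P] assms(2) by auto
  have "w x y = 0" if "x = i \<or> x = Suc i" "y = j \<or> y = Suc j" for x y
    using that assms(1) outside by (cases x; cases y) (auto simp: cell_weight_def)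
  then show ?thesis by (simp add: mixed_difference_def)
qed

text \<open>The points are encoded by natural numbers since the componentwise order on pairs is not
  linear, while the exponents of the target ring must be linearly ordered.\<close>

definition toric :: "point set set \<Rightarrow> point monomial \<Rightarrow> nat \<Rightarrow>\<^sub>0 int"
  where "toric P m = (\<Sum>v\<in>vertices P.
    Poly_Mapping.single (prod_encode v) (residue P (\<lambda>u. int (Poly_Mapping.lookup m u)) v))"

lemma toric_add: "toric P (m + n) = toric P m + toric P n"
  by (simp add: toric_def lookup_add residue_add single_add sum.distrib)

lemma toric_zero: "toric P 0 = 0"
  using toric_add[of P 0 0] by simp

lemma lookup_toric:
  assumes "finite P" "v \<in> vertices P"
  shows "Poly_Mapping.lookup (toric P m) (prod_encode v) =
    residue P (\<lambda>u. int (Poly_Mapping.lookup m u)) v"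
  using assms finite_vertices[of P]
  by (simp add: toric_def lookup_sum lookup_single when_def prod_encode_eq sum.delta)

text \<open>The exponent vector of the binomial is the sum of those of the cells in the interval, so
  the indicator \<open>w\<close> of these cells shows that it lies in the lattice.\<close>

lemma toric_exchange:
  assumes "inner_interval P a b"
  shows "toric P (var_pair a b) = toric P (var_pair (upper_left a b) (lower_right a b))"
proof -
  obtain i j k l where ab [simp]: "a = (i, j)" "b = (k, l)"
    by (cases a, cases b)
  \<comment> \<open>The half-open range matches the indexing of cells by their upper right
    vertices.\<close>
  define I where "I s t p = (if s < p \<and> p \<le> t then 1 else 0 :: int)" for s t p :: nat
  define w where "w p q = I i k p * I j l q" for p q
  have ij: "i < k" "j < l" and cells: "\<And>p q. i \<le> p \<Longrightarrow> p < k \<Longrightarrow> j \<le> q \<Longrightarrow> q < l \<Longrightarrow> cell (p, q) \<in> P"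
    using assms by (auto simp: inner_interval_iff)
  have w: "cell_weight P w"
    using cells by (auto simp: cell_weight_def w_def I_def less_Suc_eq_le Suc_le_eq)
  have I_diff: "I s t (Suc p) - I s t p = of_bool (p = s) - of_bool (p = t)" if "s < t" for s t p
    using that by (auto simp: I_def)
  \<comment> \<open>For a product of one-variable functions the mixed difference is the product of
    the two differences.\<close>
  have md: "mixed_difference w (p, q) =
      (of_bool (p = i) - of_bool (p = k)) * (of_bool (q = j) - of_bool (q = l))" for p q
    unfolding I_diff[OF ij(1), symmetric] I_diff[OF ij(2), symmetric]
    by (simp add: mixed_difference_def w_def algebra_simps)
  have "int (Poly_Mapping.lookup (var_pair a b) v) =
      int (Poly_Mapping.lookup (var_pair (upper_left a b) (lower_right a b)) v)
        + mixed_difference w v" for v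
    using ij by (cases v)
      (auto simp: md lookup_add lookup_single when_def upper_left_def lower_right_def)
  then show ?thesis
    by (simp add: toric_def residue_add residue_mixed_difference[OF w])
qed

text \<open>Equal residues leave the difference of the two solved weights as witness. Off the
  vertices of \<open>P\<close>, where the toric map records nothing, both sides vanish.\<close>

lemma toric_eqD:
  assumes "finite P" "toric P m = toric P n"
    and "Poly_Mapping.keys m \<subseteq> vertices P" "Poly_Mapping.keys n \<subseteq> vertices P"
  obtains w where "cell_weight P w"
    "\<And>v. int (Poly_Mapping.lookup m v) - int (Poly_Mapping.lookup n v) = mixed_difference w v"
proof -
  define x where "x m u = int (Poly_Mapping.lookup m u)" for m :: "point monomial" and u
  define w where "w i j = solve P (x m) i j - solve P (x n) i j" for i j
  have w: "cell_weight P w"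
    unfolding w_def by (intro cell_weight_diff cell_weight_solve)
  have md: "mixed_difference w v = mixed_difference (solve P (x m)) v - mixed_difference (solve P (x n)) v" for v
    by (simp add: mixed_difference_def w_def)
  have "x m v - x n v = mixed_difference w v" for v
  proof (cases "v \<in> vertices P")
    case True
    have "residue P (x m) v = residue P (x n) v"
      using lookup_toric[OF assms(1) True, of m] lookup_toric[OF assms(1) True, of n] assms(2)
      by (simp add: x_def[abs_def])
    then show ?thesis by (simp add: md residue_def)
  next
    case False
    then have "x m v = 0" "x n v = 0"
      using assms(3,4) by (auto simp: x_def in_keys_iff)
    then show ?thesis using mixed_difference_outside[OF w False] by simp
  qed
  then show ?thesis using that w by (simp add: x_def)
qed


section \<open>The ideal of a thin collection\<close>

context thin_collection
begin

lemma binomials_in_carrier: "inner_binomials P \<subseteq> carrier (mpoly_ring (vertices P) :: (point, 'k::field) mpoly ring)"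
proof
  fix f :: "(point, 'k) mpoly"
  assume "f \<in> inner_binomials P"
  then obtain a b where f: "f = interval_binomial a b" and ab: "inner_interval P a b"
    by (auto simp: inner_binomials_def)
  let ?n = "var_pair a b" and ?m = "var_pair (upper_left a b) (lower_right a b)"
  have keys: "Poly_Mapping.keys (var_pair c d) \<subseteq> vertices P" if "c \<in> vertices P" "d \<in> vertices P" for c d
    using Poly_Mapping.keys_add[of "Poly_Mapping.single c (1::nat)" "Poly_Mapping.single d 1"] that by auto
  have "Poly_Mapping.keys f \<subseteq> {?n, ?m}"
    unfolding f interval_binomial_eq using keys_diff by fastforce
  moreover have "Poly_Mapping.keys ?n \<subseteq> vertices P"
    using ab by (intro keys) (auto simp: inner_interval_def)
  moreover have "Poly_Mapping.keys ?m \<subseteq> vertices P"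
    by (intro keys inner_interval_antidiagonal_vertices[OF ab])
  ultimately show "f \<in> carrier (mpoly_ring (vertices P))"
    by (auto simp: mpoly_ring_def)
qed

lemma ideal_polyomino_ideal:
  "ideal (polyomino_ideal P :: (point, 'k::field) mpoly set) (mpoly_ring (vertices P))"
  unfolding polyomino_ideal_def by (rule ring.genideal_ideal[OF ring_mpoly_ring binomials_in_carrier])

lemma binomials_in_ideal:
  "inner_binomials P \<subseteq> (polyomino_ideal P :: (point, 'k::field) mpoly set)"
  unfolding polyomino_ideal_def by (rule ring.genideal_self[OF ring_mpoly_ring binomials_in_carrier])

definition toric_ideal :: "(point, 'k::field) mpoly set"
  where "toric_ideal = {f \<in> carrier (mpoly_ring (vertices P)). push_forward (toric P) f = 0}"

lemma primeideal_toric_ideal: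
  "primeideal (toric_ideal :: (point, 'k::field) mpoly set) (mpoly_ring (vertices P))"
  unfolding toric_ideal_def by (rule primeideal_push_forward_kernel[OF toric_add toric_zero])

text \<open>Each generator is a difference of two monomials with the same toric image.\<close>

lemma polyomino_ideal_subset_toric_ideal:
  "polyomino_ideal P \<subseteq> (toric_ideal :: (point, 'k::field) mpoly set)"
  unfolding polyomino_ideal_def
proof (rule ring.genideal_minimal[OF ring_mpoly_ring])
  show "ideal (toric_ideal :: (point, 'k) mpoly set) (mpoly_ring (vertices P))"
    using primeideal_toric_ideal by (rule primeideal.axioms)
  show "inner_binomials P \<subseteq> (toric_ideal :: (point, 'k) mpoly set)"
  proof
    fix f :: "(point, 'k) mpoly"
    assume f: "f \<in> inner_binomials P"
    then obtain a b where "f = interval_binomial a b" and ab: "inner_interval P a b"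
      by (auto simp: inner_binomials_def)
    then have "push_forward (toric P) f = 0"
      using toric_exchange[OF ab] by (simp add: interval_binomial_eq push_forward_diff)
    then show "f \<in> toric_ideal"
      using f binomials_in_carrier by (auto simp: toric_ideal_def)
  qed
qed

section \<open>Normal forms of monomials\<close>

lemma reduction_step:
  assumes "reducible P m" "Poly_Mapping.keys m \<subseteq> vertices P"
  obtains n where "Poly_Mapping.keys n \<subseteq> vertices P" "n \<prec> m" "diagonal_energy n < diagonal_energy m"
    "toric P n = toric P m"
    "Poly_Mapping.single m 1 - Poly_Mapping.single n 1 \<in> (polyomino_ideal P :: (point, 'k::field) mpoly set)"
proof -
  obtain a b r where ab: "inner_interval P a b"
    and m: "m = var_pair (upper_left a b) (lower_right a b) + r"
    and r: "Poly_Mapping.keys r \<subseteq> Poly_Mapping.keys m"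
    using assms(1) by (rule reducible_split)
  let ?n = "var_pair a b + r"
  have proper: "proper a b" and "a \<in> vertices P" "b \<in> vertices P"
    using ab by (auto simp: inner_interval_def)
  moreover have "Poly_Mapping.keys ?n \<subseteq> {a} \<union> {b} \<union> Poly_Mapping.keys r"
    using Poly_Mapping.keys_add[of "var_pair a b" r]
      Poly_Mapping.keys_add[of "Poly_Mapping.single a (1::nat)" "Poly_Mapping.single b 1"] by auto
  ultimately have keys: "Poly_Mapping.keys ?n \<subseteq> vertices P"
    using r assms(2) by blast
  have "(interval_binomial a b :: (point, 'k) mpoly) \<in> polyomino_ideal P"
    using interval_binomial_in[OF ab] binomials_in_ideal by blast
  \<comment> \<open>The sign is needed because \<open>m\<close> contains the antidiagonal product,
    which has coefficient -1 in the binomial.\<close>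
  then have "Poly_Mapping.single r (- 1) * (interval_binomial a b :: (point, 'k) mpoly) \<in> polyomino_ideal P"
    using r assms(2) by (intro ideal_single_mult[OF ideal_polyomino_ideal]) auto
  moreover have "Poly_Mapping.single r (- 1) * (interval_binomial a b :: (point, 'k) mpoly) =
      Poly_Mapping.single m 1 - Poly_Mapping.single ?n 1"
    unfolding interval_binomial_eq right_diff_distrib mult_single m
    by (simp add: single_uminus add_ac)
  ultimately have "Poly_Mapping.single m 1 - Poly_Mapping.single ?n 1 \<in> (polyomino_ideal P :: (point, 'k) mpoly set)"
    by simp
  moreover have "toric P ?n = toric P m"
    unfolding m toric_add[of P _ r] toric_exchange[OF ab] ..
  moreover have "?n \<prec> m" "diagonal_energy ?n < diagonal_energy m"
    unfolding m by (rule grevlex_exchange[OF proper], rule diagonal_energy_exchange[OF proper])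
  ultimately show ?thesis
    using keys by (intro that[of ?n])
qed

text \<open>Reduction terminates by induction on \<open>diagonal_energy\<close>. The comparison in
  the monomial order is carried along for the argument on initial monomials.\<close>

lemma normal_form:
  assumes "Poly_Mapping.keys m \<subseteq> vertices P"
  shows "\<exists>n. Poly_Mapping.keys n \<subseteq> vertices P \<and> \<not> reducible P n \<and> (n = m \<or> n \<prec> m) \<and>
    toric P n = toric P m \<and>
    Poly_Mapping.single m 1 - Poly_Mapping.single n 1 \<in> (polyomino_ideal P :: (point, 'k::field) mpoly set)"
  using assms
proof (induction m rule: measure_induct_rule[of diagonal_energy])
  case (less m)
  show ?case
  proof (cases "reducible P m")
    case True
    then obtain m' where m': "Poly_Mapping.keys m' \<subseteq> vertices P" "m' \<prec> m"
      "diagonal_energy m' < diagonal_energy m" "toric P m' = toric P m"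
      "Poly_Mapping.single m 1 - Poly_Mapping.single m' 1 \<in> (polyomino_ideal P :: (point, 'k) mpoly set)"
      using less.prems by (rule reduction_step)
    obtain n where n: "Poly_Mapping.keys n \<subseteq> vertices P" "\<not> reducible P n" "n = m' \<or> n \<prec> m'"
      "toric P n = toric P m'"
      "Poly_Mapping.single m' 1 - Poly_Mapping.single n 1 \<in> (polyomino_ideal P :: (point, 'k) mpoly set)"
      using less.IH[OF m'(3,1)] by blast
    have "Poly_Mapping.single m 1 - Poly_Mapping.single n 1 \<in> (polyomino_ideal P :: (point, 'k) mpoly set)"
      using ideal_add[OF ideal_polyomino_ideal m'(5) n(5)] by simp
    moreover have "n \<prec> m"
      using n(3) m'(2) grevlex_trans by blast
    ultimately show ?thesis
      using n(1,2,4) m'(4) by auto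
  next
    case False
    then show ?thesis
      using less.prems ideal_zero[OF ideal_polyomino_ideal] by (intro exI[of _ m]) simp
  qed
qed

lemma irreducible_toric_unique:
  assumes "\<not> reducible P m" "\<not> reducible P n" "toric P m = toric P n"
    and "Poly_Mapping.keys m \<subseteq> vertices P" "Poly_Mapping.keys n \<subseteq> vertices P"
  shows "m = n"
proof -
  obtain w where w: "cell_weight P w"
    "\<And>v. int (Poly_Mapping.lookup m v) - int (Poly_Mapping.lookup n v) = mixed_difference w v"
    using toric_eqD[OF finite assms(3-5)] by blast
  show ?thesis
    by (rule irreducible_unique[OF w(1) assms(1,2) w(2)])
qed

text \<open>If the initial monomial \<open>M\<close> were irreducible, any other monomial of the
  support with the same toric image would have normal form \<open>M\<close>, although that form lies
  below \<open>M\<close>. So \<open>M\<close> is alone in its class and its coefficient survives in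
  the image of \<open>f\<close>, which is zero.\<close>

lemma reducible_initial_monomial:
  fixes f :: "(point, 'k::field) mpoly"
  assumes f: "f \<in> toric_ideal" "f \<noteq> 0"
  shows "reducible P (initial_monomial (grevlex var_less) f)"
proof (rule ccontr)
  define M where "M = initial_monomial (grevlex var_less) f"
  assume "\<not> reducible P (initial_monomial (grevlex var_less) f)"
  then have irr: "\<not> reducible P M" by (simp add: M_def)
  have M: "M \<in> Poly_Mapping.keys f" "\<And>n. n \<in> Poly_Mapping.keys f \<Longrightarrow> n \<noteq> M \<Longrightarrow> n \<prec> M"
    using initial_monomial_greatest[OF f(2)] by (auto simp: M_def)
  have keys: "Poly_Mapping.keys n \<subseteq> vertices P" if "n \<in> Poly_Mapping.keys f" for n
    using f(1) that by (auto simp: toric_ideal_def mpoly_ring_def)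
  let ?K = "{n \<in> Poly_Mapping.keys f. toric P n = toric P M}"
  have "n = M" if nK: "n \<in> ?K" for n
  proof (rule ccontr)
    assume "n \<noteq> M"
    obtain n' where n': "Poly_Mapping.keys n' \<subseteq> vertices P" "\<not> reducible P n'" "n' = n \<or> n' \<prec> n"
      "toric P n' = toric P n"
      using normal_form[OF keys[of n], where 'k = 'k] nK by blast
    have "n' = M"
      using irreducible_toric_unique[OF n'(2) irr _ n'(1) keys[OF M(1)]] n'(4) nK by simp
    moreover have "n \<prec> M"
      using M(2) nK \<open>n \<noteq> M\<close> by simp
    ultimately show False
      using n'(3) \<open>n \<noteq> M\<close> grevlex_trans[of M n M] grevlex_irrefl[of M] by auto
  qed
  then have "?K = {M}" using M(1) by auto
  then have "Poly_Mapping.lookup (push_forward (toric P) f) (toric P M) = Poly_Mapping.lookup f M"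
    by (simp add: lookup_push_forward)
  then show False
    using f(1) M(1) by (simp add: toric_ideal_def in_keys_iff)
qed

text \<open>Replacing every monomial of \<open>f\<close> by its normal form changes \<open>f\<close>
  by an element of the ideal. The result \<open>g\<close> has only irreducible monomials and stays
  in the kernel, so it is zero.\<close>

lemma toric_ideal_subset_polyomino_ideal:
  "(toric_ideal :: (point, 'k::field) mpoly set) \<subseteq> polyomino_ideal P"
proof
  fix f :: "(point, 'k) mpoly"
  assume f: "f \<in> toric_ideal"
  have keys: "Poly_Mapping.keys m \<subseteq> vertices P" if "m \<in> Poly_Mapping.keys f" for m
    using f that by (auto simp: toric_ideal_def mpoly_ring_def)
  have "\<exists>nf. \<forall>m\<in>Poly_Mapping.keys f. Poly_Mapping.keys (nf m) \<subseteq> vertices P \<and> \<not> reducible P (nf m) \<and>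
    toric P (nf m) = toric P m \<and>
    Poly_Mapping.single m 1 - Poly_Mapping.single (nf m) 1 \<in> (polyomino_ideal P :: (point, 'k) mpoly set)"
    by (intro bchoice ballI) (use normal_form[where 'k = 'k] keys in blast)
  then obtain nf where
    nf: "\<And>m. m \<in> Poly_Mapping.keys f \<Longrightarrow> Poly_Mapping.keys (nf m) \<subseteq> vertices P"
      "\<And>m. m \<in> Poly_Mapping.keys f \<Longrightarrow> \<not> reducible P (nf m)"
      "\<And>m. m \<in> Poly_Mapping.keys f \<Longrightarrow> toric P (nf m) = toric P m"
      "\<And>m. m \<in> Poly_Mapping.keys f \<Longrightarrow>
        Poly_Mapping.single m 1 - Poly_Mapping.single (nf m) 1 \<in> (polyomino_ideal P :: (point, 'k) mpoly set)"
    by blast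
  define g where "g = push_forward nf f"
  \<comment> \<open>Only this inclusion holds in general, since normal forms may coincide and their
    coefficients cancel.\<close>
  have g_keys: "\<exists>m\<in>Poly_Mapping.keys f. n = nf m" if "n \<in> Poly_Mapping.keys g" for n
  proof (rule ccontr)
    assume "\<not> (\<exists>m\<in>Poly_Mapping.keys f. n = nf m)"
    then have "{m \<in> Poly_Mapping.keys f. nf m = n} = {}" by auto
    then have "Poly_Mapping.lookup g n = 0"
      unfolding g_def lookup_push_forward by (simp only: sum.empty)
    then show False using that by (simp add: in_keys_iff)
  qed
  have "push_forward (toric P) g = push_forward (toric P) f"
    unfolding g_def push_forward_def[of nf] push_forward_sum push_forward_single
    by (simp add: push_forward_def[of "toric P" f] nf(3))
  then have "g \<in> toric_ideal"
    using f g_keys nf(1) by (auto simp: toric_ideal_def mpoly_ring_def)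
  have "g = 0"
  proof (rule ccontr)
    assume "g \<noteq> 0"
    then show False
      using reducible_initial_monomial[OF \<open>g \<in> toric_ideal\<close>] initial_monomial_greatest(1) g_keys nf(2)
      by metis
  qed
  have "f - g = (\<Sum>m\<in>Poly_Mapping.keys f. Poly_Mapping.single 0 (Poly_Mapping.lookup f m) *
      (Poly_Mapping.single m 1 - Poly_Mapping.single (nf m) 1))"
    by (simp add: right_diff_distrib mult_single sum_subtractf sum_single_keys g_def push_forward_def)
  also have "\<dots> \<in> polyomino_ideal P"
    by (intro ideal_sum[OF ideal_polyomino_ideal] ideal_single_mult[OF ideal_polyomino_ideal] nf(4)) simp_all
  finally show "f \<in> polyomino_ideal P"
    by (simp add: \<open>g = 0\<close>)
qed

section \<open>Equality of the two ideals and the Groebner basis\<close>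

lemma polyomino_ideal_eq: "polyomino_ideal P = (toric_ideal :: (point, 'k::field) mpoly set)"
  using polyomino_ideal_subset_toric_ideal toric_ideal_subset_polyomino_ideal by blast

lemma finite_inner_binomials: "finite (inner_binomials P :: (point, 'k::field) mpoly set)"
proof -
  have "inner_binomials P \<subseteq>
      (\<lambda>(a, b). interval_binomial a b :: (point, 'k) mpoly) ` (vertices P \<times> vertices P)"
    by (auto simp: inner_binomials_def inner_interval_def)
  then show ?thesis
    using finite_vertices[OF finite] by (meson finite_SigmaI finite_imageI finite_subset)
qed

text \<open>Initial monomials of ideal elements are reducible, hence multiples of initial monomials
  of inner binomials, so the two initial ideals agree.\<close>

lemma groebner_basis_inner_binomials:
  "groebner_basis (grevlex var_less) (vertices P)
    (inner_binomials P :: (point, 'k::field) mpoly set) (polyomino_ideal P)"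
  unfolding groebner_basis_def
proof (intro conjI)
  let ?R = "mpoly_ring (vertices P) :: (point, 'k) mpoly ring"
  let ?in = "initial_monomial (grevlex var_less) :: (point, 'k) mpoly \<Rightarrow> point monomial"
  let ?L = "\<lambda>F. {monom (?in f) | f. f \<in> F \<and> f \<noteq> 0} :: (point, 'k) mpoly set"
  let ?G = "inner_binomials P :: (point, 'k) mpoly set"
  let ?I = "polyomino_ideal P :: (point, 'k) mpoly set"
  have I_carrier: "?I \<subseteq> carrier ?R"
    using ideal.Icarr[OF ideal_polyomino_ideal] by blast
  have L_carrier: "?L ?I \<subseteq> carrier ?R"
  proof clarify
    fix f assume f: "f \<in> ?I" "f \<noteq> 0"
    then have "Poly_Mapping.keys (?in f) \<subseteq> vertices P"
      using I_carrier initial_monomial_greatest(1)[OF f(2)] by (auto simp: mpoly_ring_def)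
    then show "monom (?in f) \<in> carrier ?R"
      unfolding monom_def by (rule single_in_carrier)
  qed
  have L_mono: "?L ?G \<subseteq> ?L ?I"
    using binomials_in_ideal by blast
  have ideal_G: "ideal (initial_ideal (grevlex var_less) (vertices P) ?G) ?R"
    unfolding initial_ideal_def using L_mono L_carrier
    by (intro ring.genideal_ideal[OF ring_mpoly_ring]) blast
  have "?L ?I \<subseteq> initial_ideal (grevlex var_less) (vertices P) ?G"
  proof clarify
    fix f assume f: "f \<in> ?I" "f \<noteq> 0"
    then have "reducible P (?in f)"
      by (intro reducible_initial_monomial) (simp_all add: polyomino_ideal_eq)
    then obtain a b r where ab: "inner_interval P a b"
      and m: "?in f = var_pair (upper_left a b) (lower_right a b) + r"
      and r: "Poly_Mapping.keys r \<subseteq> Poly_Mapping.keys (?in f)"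
      by (rule reducible_split)
    have "proper a b" using ab by (simp add: inner_interval_def)
    have keys: "Poly_Mapping.keys (?in f) \<subseteq> vertices P"
      using f I_carrier initial_monomial_greatest(1)[OF f(2)] by (auto simp: mpoly_ring_def)
    have "monom (?in (interval_binomial a b)) \<in> ?L ?G"
      using interval_binomial_in[OF ab] initial_interval_binomial(2)[OF \<open>proper a b\<close>] by blast
    then have "monom (?in (interval_binomial a b)) \<in> initial_ideal (grevlex var_less) (vertices P) ?G"
      unfolding initial_ideal_def
      using ring.genideal_self[OF ring_mpoly_ring, of "?L ?G"] L_mono L_carrier by blast
    then have "Poly_Mapping.single r 1 * monom (?in (interval_binomial a b))
        \<in> initial_ideal (grevlex var_less) (vertices P) ?G"
      using r keys by (intro ideal_single_mult[OF ideal_G]) auto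
    then show "monom (?in f) \<in> initial_ideal (grevlex var_less) (vertices P) ?G"
      by (simp add: monom_def initial_interval_binomial(1)[OF \<open>proper a b\<close>] m mult_single add_ac)
  qed
  then have "initial_ideal (grevlex var_less) (vertices P) ?I
      \<subseteq> initial_ideal (grevlex var_less) (vertices P) ?G"
    unfolding initial_ideal_def[of _ _ ?I] by (rule ring.genideal_minimal[OF ring_mpoly_ring ideal_G])
  moreover have "initial_ideal (grevlex var_less) (vertices P) ?G
      \<subseteq> initial_ideal (grevlex var_less) (vertices P) ?I"
    unfolding initial_ideal_def
    by (intro ring.genideal_minimal[OF ring_mpoly_ring] ring.genideal_ideal[OF ring_mpoly_ring L_carrier]
        order_trans[OF L_mono] ring.genideal_self[OF ring_mpoly_ring L_carrier])
  ultimately show "initial_ideal (grevlex var_less) (vertices P) ?G =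
      initial_ideal (grevlex var_less) (vertices P) ?I"
    by blast
  show "0 \<notin> ?G"
    using initial_interval_binomial(2) by (fastforce simp: inner_binomials_def inner_interval_def)
qed (rule finite_inner_binomials binomials_in_ideal)+

end


theorem corollary5p2:
  fixes P :: "point set set"
  assumes "collection_of_cells P"
    and "thin P"
    and "\<not> (\<exists>i j. j \<ge> 2 \<and> has_cell_with_upper_left P (i, j)
          \<and> has_cell_with_upper_left P (i + 1, j - 1)
          \<and> has_cell_with_upper_left P (i + 2, j - 2))"
    and "\<And>i1 j1 j2. j1 < j2 \<Longrightarrow> maximal_inner_interval P (i1, j1) (i1 + 1, j2) \<Longrightarrow>
          \<not> has_cell_with_lower_right P (i1, j2) \<and> \<not> has_cell_with_upper_left P (i1 + 1, j1)"
    and "\<And>i1 i2 j1. i1 < i2 \<Longrightarrow> maximal_inner_interval P (i1, j1) (i2, j1 + 1) \<Longrightarrow>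
          \<not> has_cell_with_lower_right P (i1, j1 + 1) \<and> \<not> has_cell_with_upper_left P (i2, j1)"
  shows "groebner_basis (grevlex var_less) (vertices P)
           (inner_binomials P :: (point, 'k::field) mpoly set) (polyomino_ideal P)
         \<and> (polyomino P \<longrightarrow>
             primeideal (polyomino_ideal P :: (point, 'k) mpoly set) (mpoly_ring (vertices P)))"
proof -
  interpret thin_collection P
    by unfold_locales (use assms in \<open>auto simp: collection_of_cells_def\<close>)
  \<comment> \<open>Primality is inherited from the toric kernel through the equality of the two
    ideals.\<close>
  show ?thesis
    using groebner_basis_inner_binomials[where 'k = 'k] primeideal_toric_ideal[where 'k = 'k]
    by (simp add: polyomino_ideal_eq)
qed

end
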